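(* Let $Y=\varprojlim Y_n\subseteq \varprojlim \beta H_n=S(G)$ be compact, with $Y_m\subseteq \beta H_m$ for each $m\in\mathbb{N}$, and let $F_m$ be the filter of clopen neighborhoods of $Y_m$. Then $Y$ is a minimal right ideal of $S(G)$ if and only if for each $m\in\mathbb{N}$, $F_m$ is a $\mathcal{T}_m$-ultrafilter, i.e. $F_m\in\beta(\mathcal{T}_m)$.
   Context: Let $L$ be a relational language and $\mathbf{K}$ a Fraïssé structure, i.e. a countably infinite $L$-structure that is ultrahomogeneous (every isomorphism between finite substructures of $\mathbf{K}$ extends to an automorphism of $\mathbf{K}$). Let $G=\mathrm{Aut}(\mathbf{K})$. Fix an exhaustion $\mathbf{K}=\bigcup_n\mathbf{A}_n$ by finite substructures with $\mathbf{A}_m\subseteq\mathbf{A}_n$ for $m\le n$. $\mathrm{Emb}(\mathbf{A},\mathbf{B})$ is the set of embeddings of $\mathbf{A}$ into $\mathbf{B}$, and $H_n=\mathrm{Emb}(\mathbf{A}_n,\mathbf{K})$. $G$ acts on the right on $2^{H_m}$ (product topology) by $(\chi_A\cdot g)(f)=\chi_A(g\circ f)$ for $A\subseteq H_m$, $g\in G$, $f\in H_m$. A set $T\subseteq H_m$ is thick if $\chi_{H_m}\in\overline{\chi_T\cdot G}$; $\mathcal{T}_m$ denotes the collection of thick subsets of $H_m$. It is closed upwards, contains $H_m$ and does not contain $\emptyset$. A $\mathcal{T}_m$-filter is a filter $F$ on $H_m$ with $F\subseteq\mathcal{T}_m$; a $\mathcal{T}_m$-ultrafilter is a maximal $\mathcal{T}_m$-filter,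 and $\beta(\mathcal{T}_m)$ is the set of $\mathcal{T}_m$-ultrafilters. $\beta H_n$ is the compact space of ultrafilters on the discrete set $H_n$, with basic clopen sets $\overline{T}=\{p\in\beta H_n: T\in p\}$ for $T\subseteq H_n$. For $m\le n$, the restriction map $H_n\to H_m$, $x\mapsto x|_{\mathbf{A}_m}$, extends to a continuous map $\tilde{\imath}^n_m:\beta H_n\to\beta H_m$. $S(G)=\varprojlim\beta H_n$ is the inverse limit along the maps $\tilde{\imath}^n_m$; for $\alpha\in S(G)$, $\alpha(m)\in\beta H_m$ is its $m$-th coordinate. For $\alpha\in S(G)$ and $f\in H_m$, let $\alpha\cdot f\in\beta H_m$ be given by: $S\in\alpha\cdot f$ iff $\{x\in H_n: x\circ f\in S\}\in\alpha(n)$, where $n\ge m$ is large enough that $\mathrm{ran}(f)\subseteq\mathbf{A}_n$ (independent of such $n$). $S(G)$ is a compact left-topological semigroup with multiplication: for $S\subseteq H_m$, $S\in(\alpha\gamma)(m)$ iff $\{f\in H_m: S\in\alpha\cdot f\}\in\gamma(m)$. A right ideal is a nonempty $R\subseteq S(G)$ with $R\,S(G)\subseteq R$; a minimal right ideal is one containing no properly smaller right ideal. Convention: writing $Y=\varprojlim Y_n$ implies that the $Y_n\subseteq\beta H_n$ are closed and $\tilde{\imath}^n_m(Y_n)=Y_m$ for $m\le n$. The filter of clopen neighborhoods of a closed set $Y_m\subseteq\beta H_m$ is the filter $F_m$ on $H_m$ with $Y_m=\bigcap_{T\in F_m}\overline{T}$, i.e. $F_m=\{T\subseteq H_m: Y_m\subseteq\overline{T}\}$.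 *)

theory Defs
  imports "HOL-Analysis.Analysis"
begin

section \<open>Relational structures\<close>

record 'r language =
  symbols :: "'r set"
  arity :: "'r \<Rightarrow> nat"

text \<open>Relations are sets of tuples, a tuple being a list of the appropriate length.\<close>

record ('a, 'r) rel_structure =
  universe :: "'a set"
  interp :: "'r \<Rightarrow> 'a list set"

definition is_structure :: "'r language \<Rightarrow> ('a, 'r) rel_structure \<Rightarrow> bool" where
  "is_structure L K \<longleftrightarrow>
     (\<forall>R\<in>symbols L. interp K R \<subseteq> {xs. length xs = arity L R \<and> set xs \<subseteq> universe K})"

text \<open>Since the language is relational, every subset of the universe carries a unique
  substructure; the empty substructure is allowed.\<close>

definition substructure :: "'r language \<Rightarrow> ('a, 'r) rel_structure \<Rightarrow> ('a, 'r) rel_structure \<Rightarrow> bool" where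
  "substructure L A B \<longleftrightarrow>
     universe A \<subseteq> universe B \<and>
     (\<forall>R\<in>symbols L. interp A R = {xs \<in> interp B R. set xs \<subseteq> universe A})"

text \<open>Embeddings are extensional functions (\<open>undefined\<close> off the domain), so that
  \<open>Emb L A B\<close> contains each embedding exactly once.\<close>

definition Emb :: "'r language \<Rightarrow> ('a, 'r) rel_structure \<Rightarrow> ('b, 'r) rel_structure \<Rightarrow> ('a \<Rightarrow> 'b) set" where
  "Emb L A B =
     {f \<in> universe A \<rightarrow>\<^sub>E universe B. inj_on f (universe A) \<and>
        (\<forall>R\<in>symbols L. \<forall>xs. length xs = arity L R \<longrightarrow> set xs \<subseteq> universe A \<longrightarrow>
           (xs \<in> interp A R \<longleftrightarrow> map f xs \<in> interp B R))}"

definition Iso :: "'r language \<Rightarrow> ('a, 'r) rel_structure \<Rightarrow> ('b, 'r) rel_structure \<Rightarrow> ('a \<Rightarrow> 'b) set" where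
  "Iso L A B = {f \<in> Emb L A B. f ` universe A = universe B}"

definition Aut :: "'r language \<Rightarrow> ('a, 'r) rel_structure \<Rightarrow> ('a \<Rightarrow> 'a) set" where
  "Aut L K = Iso L K K"

definition ultrahomogeneous :: "'r language \<Rightarrow> ('a, 'r) rel_structure \<Rightarrow> bool" where
  "ultrahomogeneous L K \<longleftrightarrow>
     (\<forall>A B f. substructure L A K \<longrightarrow> substructure L B K \<longrightarrow>
        finite (universe A) \<longrightarrow> finite (universe B) \<longrightarrow> f \<in> Iso L A B \<longrightarrow>
        (\<exists>g\<in>Aut L K. \<forall>x\<in>universe A. g x = f x))"

definition fraisse_structure :: "'r language \<Rightarrow> ('a, 'r) rel_structure \<Rightarrow> bool" where
  "fraisse_structure L K \<longleftrightarrow>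
     is_structure L K \<and> countable (universe K) \<and> infinite (universe K) \<and> ultrahomogeneous L K"

definition exhaustion ::
    "'r language \<Rightarrow> ('a, 'r) rel_structure \<Rightarrow> (nat \<Rightarrow> ('a, 'r) rel_structure) \<Rightarrow> bool" where
  "exhaustion L K A \<longleftrightarrow>
     (\<forall>n. substructure L (A n) K \<and> finite (universe (A n))) \<and>
     (\<forall>m n. m \<le> n \<longrightarrow> substructure L (A m) (A n)) \<and>
     universe K = (\<Union>n. universe (A n))"

definition H ::
    "'r language \<Rightarrow> ('a, 'r) rel_structure \<Rightarrow> (nat \<Rightarrow> ('a, 'r) rel_structure) \<Rightarrow> nat \<Rightarrow> ('a \<Rightarrow> 'a) set" where
  "H L K A n = Emb L (A n) K"


section \<open>Filters and ultrafilters on a set\<close>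

text \<open>Filters are families of subsets of a fixed set \<open>X\<close>, and are proper.\<close>

definition filter_on :: "'x set \<Rightarrow> 'x set set \<Rightarrow> bool" where
  "filter_on X F \<longleftrightarrow>
     F \<subseteq> Pow X \<and> X \<in> F \<and> {} \<notin> F \<and>
     (\<forall>S\<in>F. \<forall>T\<in>F. S \<inter> T \<in> F) \<and>
     (\<forall>S\<in>F. \<forall>T. S \<subseteq> T \<longrightarrow> T \<subseteq> X \<longrightarrow> T \<in> F)"

definition beta :: "'x set \<Rightarrow> 'x set set set" where
  "beta X = {p. filter_on X p \<and> (\<forall>q. filter_on X q \<longrightarrow> p \<subseteq> q \<longrightarrow> q = p)}"

definition basic_clopen :: "'x set \<Rightarrow> 'x set \<Rightarrow> 'x set set set" where
  "basic_clopen X T = {p \<in> beta X. T \<in> p}"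

definition beta_topology :: "'x set \<Rightarrow> 'x set set topology" where
  "beta_topology X = topology_generated_by (basic_clopen X ` Pow X)"

text \<open>The continuous extension \<open>beta X \<rightarrow> beta Z\<close> of a map \<open>h: X \<rightarrow> Z\<close> of discrete sets;
  see \<open>continuous_map_beta_map\<close> and \<open>beta_map_principal\<close>.\<close>

definition beta_map :: "'x set \<Rightarrow> 'z set \<Rightarrow> ('x \<Rightarrow> 'z) \<Rightarrow> 'x set set \<Rightarrow> 'z set set" where
  "beta_map X Z h p = {S. S \<subseteq> Z \<and> {x \<in> X. h x \<in> S} \<in> p}"

definition principal_on :: "'x set \<Rightarrow> 'x \<Rightarrow> 'x set set" where
  "principal_on X x = {S. S \<subseteq> X \<and> x \<in> S}"

definition family_filter :: "'x set \<Rightarrow> 'x set set \<Rightarrow> 'x set set \<Rightarrow> bool" where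
  "family_filter X \<T> F \<longleftrightarrow> filter_on X F \<and> F \<subseteq> \<T>"

definition beta_family :: "'x set \<Rightarrow> 'x set set \<Rightarrow> 'x set set set" where
  "beta_family X \<T> =
     {F. family_filter X \<T> F \<and> (\<forall>F'. family_filter X \<T> F' \<longrightarrow> F \<subseteq> F' \<longrightarrow> F' = F)}"

definition nbhd_filter :: "'x set \<Rightarrow> 'x set set set \<Rightarrow> 'x set set" where
  "nbhd_filter X Y = {T. T \<subseteq> X \<and> Y \<subseteq> basic_clopen X T}"


section \<open>Thick sets\<close>

text \<open>Points of \<open>2\<^sup>X\<close> are extensional functions from \<open>X\<close> to \<open>bool\<close>.\<close>

definition cantor_topology :: "'x set \<Rightarrow> ('x \<Rightarrow> bool) topology" where
  "cantor_topology X = product_topology (\<lambda>_. discrete_topology UNIV) X"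

definition char_fun :: "'x set \<Rightarrow> 'x set \<Rightarrow> 'x \<Rightarrow> bool" where
  "char_fun X T = (\<lambda>x\<in>X. x \<in> T)"

definition act_right ::
    "'r language \<Rightarrow> ('a, 'r) rel_structure \<Rightarrow> (nat \<Rightarrow> ('a, 'r) rel_structure) \<Rightarrow> nat \<Rightarrow>
     (('a \<Rightarrow> 'a) \<Rightarrow> bool) \<Rightarrow> ('a \<Rightarrow> 'a) \<Rightarrow> (('a \<Rightarrow> 'a) \<Rightarrow> bool)" where
  "act_right L K A m c g = (\<lambda>f\<in>H L K A m. c (compose (universe (A m)) g f))"

definition thick ::
    "'r language \<Rightarrow> ('a, 'r) rel_structure \<Rightarrow> (nat \<Rightarrow> ('a, 'r) rel_structure) \<Rightarrow> nat \<Rightarrow>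
     ('a \<Rightarrow> 'a) set \<Rightarrow> bool" where
  "thick L K A m T \<longleftrightarrow>
     char_fun (H L K A m) (H L K A m) \<in>
       cantor_topology (H L K A m) closure_of
         (act_right L K A m (char_fun (H L K A m) T) ` Aut L K)"

definition Thick ::
    "'r language \<Rightarrow> ('a, 'r) rel_structure \<Rightarrow> (nat \<Rightarrow> ('a, 'r) rel_structure) \<Rightarrow> nat \<Rightarrow>
     ('a \<Rightarrow> 'a) set set" where
  "Thick L K A m = {T. T \<subseteq> H L K A m \<and> thick L K A m T}"


section \<open>The semigroup \<open>S(G)\<close>\<close>

definition res ::
    "'r language \<Rightarrow> ('a, 'r) rel_structure \<Rightarrow> (nat \<Rightarrow> ('a, 'r) rel_structure) \<Rightarrow> nat \<Rightarrow> nat \<Rightarrow>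
     ('a \<Rightarrow> 'a) set set \<Rightarrow> ('a \<Rightarrow> 'a) set set" where
  "res L K A n m = beta_map (H L K A n) (H L K A m) (\<lambda>x. restrict x (universe (A m)))"

definition SG ::
    "'r language \<Rightarrow> ('a, 'r) rel_structure \<Rightarrow> (nat \<Rightarrow> ('a, 'r) rel_structure) \<Rightarrow>
     (nat \<Rightarrow> ('a \<Rightarrow> 'a) set set) set" where
  "SG L K A =
     {\<alpha>. (\<forall>n. \<alpha> n \<in> beta (H L K A n)) \<and> (\<forall>m n. m \<le> n \<longrightarrow> res L K A n m (\<alpha> n) = \<alpha> m)}"

definition SG_topology ::
    "'r language \<Rightarrow> ('a, 'r) rel_structure \<Rightarrow> (nat \<Rightarrow> ('a, 'r) rel_structure) \<Rightarrow>
     (nat \<Rightarrow> ('a \<Rightarrow> 'a) set set) topology" where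
  "SG_topology L K A =
     subtopology (product_topology (\<lambda>n. beta_topology (H L K A n)) UNIV) (SG L K A)"

text \<open>The ultrafilter \<open>\<alpha> \<cdot> f\<close> on \<open>H\<^sub>m\<close> for \<open>f \<in> H\<^sub>m\<close>. Whether the condition holds does not
  depend on the admissible \<open>n\<close>, see \<open>SG_dot_iff\<close>; an admissible \<open>n\<close> exists since
  \<open>f\<close> has finite range.\<close>

definition SG_dot ::
    "'r language \<Rightarrow> ('a, 'r) rel_structure \<Rightarrow> (nat \<Rightarrow> ('a, 'r) rel_structure) \<Rightarrow> nat \<Rightarrow>
     (nat \<Rightarrow> ('a \<Rightarrow> 'a) set set) \<Rightarrow> ('a \<Rightarrow> 'a) \<Rightarrow> ('a \<Rightarrow> 'a) set set" where
  "SG_dot L K A m \<alpha> f =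
     {S. S \<subseteq> H L K A m \<and>
         (\<exists>n\<ge>m. f ` universe (A m) \<subseteq> universe (A n) \<and>
                {x \<in> H L K A n. compose (universe (A m)) x f \<in> S} \<in> \<alpha> n)}"

definition SG_mult ::
    "'r language \<Rightarrow> ('a, 'r) rel_structure \<Rightarrow> (nat \<Rightarrow> ('a, 'r) rel_structure) \<Rightarrow>
     (nat \<Rightarrow> ('a \<Rightarrow> 'a) set set) \<Rightarrow> (nat \<Rightarrow> ('a \<Rightarrow> 'a) set set) \<Rightarrow>
     (nat \<Rightarrow> ('a \<Rightarrow> 'a) set set)" where
  "SG_mult L K A \<alpha> \<gamma> =
     (\<lambda>m. {S. S \<subseteq> H L K A m \<and> {f \<in> H L K A m. S \<in> SG_dot L K A m \<alpha> f} \<in> \<gamma> m})"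

definition right_ideal ::
    "'r language \<Rightarrow> ('a, 'r) rel_structure \<Rightarrow> (nat \<Rightarrow> ('a, 'r) rel_structure) \<Rightarrow>
     (nat \<Rightarrow> ('a \<Rightarrow> 'a) set set) set \<Rightarrow> bool" where
  "right_ideal L K A R \<longleftrightarrow>
     R \<noteq> {} \<and> R \<subseteq> SG L K A \<and> (\<forall>\<alpha>\<in>R. \<forall>\<gamma>\<in>SG L K A. SG_mult L K A \<alpha> \<gamma> \<in> R)"

definition minimal_right_ideal ::
    "'r language \<Rightarrow> ('a, 'r) rel_structure \<Rightarrow> (nat \<Rightarrow> ('a, 'r) rel_structure) \<Rightarrow>
     (nat \<Rightarrow> ('a \<Rightarrow> 'a) set set) set \<Rightarrow> bool" where
  "minimal_right_ideal L K A R \<longleftrightarrow>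
     right_ideal L K A R \<and> (\<forall>R'. right_ideal L K A R' \<longrightarrow> R' \<subseteq> R \<longrightarrow> R' = R)"

text \<open>The relation \<open>Y = lim Y\<^sub>n\<close>, including the conventions on the \<open>Y\<^sub>n\<close> that this notation
  carries: they are closed and the bonding maps are onto.\<close>

definition is_inverse_limit ::
    "'r language \<Rightarrow> ('a, 'r) rel_structure \<Rightarrow> (nat \<Rightarrow> ('a, 'r) rel_structure) \<Rightarrow>
     (nat \<Rightarrow> ('a \<Rightarrow> 'a) set set) set \<Rightarrow> (nat \<Rightarrow> ('a \<Rightarrow> 'a) set set set) \<Rightarrow> bool" where
  "is_inverse_limit L K A Y Ys \<longleftrightarrow>
     (\<forall>n. closedin (beta_topology (H L K A n)) (Ys n)) \<and>
     (\<forall>m n. m \<le> n \<longrightarrow> res L K A n m ` Ys n = Ys m) \<and>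
     Y = {\<alpha> \<in> SG L K A. \<forall>n. \<alpha> n \<in> Ys n}"


section \<open>Consistency of the definitions\<close>

lemma beta_iff:
  "p \<in> beta X \<longleftrightarrow> filter_on X p \<and> (\<forall>S\<subseteq>X. S \<in> p \<or> X - S \<in> p)"
proof
  assume p: "p \<in> beta X"
  then have fp: "filter_on X p" and
    mx: "\<And>q. filter_on X q \<Longrightarrow> p \<subseteq> q \<Longrightarrow> q = p" by (auto simp: beta_def)
  have "S \<in> p" if S: "S \<subseteq> X" and nS: "X - S \<notin> p" for S
  proof -
    define q where "q = {T. T \<subseteq> X \<and> (\<exists>U\<in>p. U \<inter> S \<subseteq> T)}"
    have meet: "U \<inter> S \<noteq> {}" if "U \<in> p" for U
    proof
      assume "U \<inter> S = {}"
      then have "U \<subseteq> X - S" using fp that by (auto simp: filter_on_def)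
      then show False using fp that nS unfolding filter_on_def by blast
    qed
    have "filter_on X q"
      unfolding filter_on_def
    proof (intro conjI ballI allI impI)
      show "q \<subseteq> Pow X" by (auto simp: q_def)
      show "X \<in> q" using fp S by (auto simp: q_def filter_on_def)
      show "{} \<notin> q" using meet by (auto simp: q_def)
      fix T assume T: "T \<in> q"
      { fix T' assume T': "T' \<in> q"
        from T T' obtain U U' where U: "U \<in> p" "U' \<in> p" "U \<inter> S \<subseteq> T" "U' \<inter> S \<subseteq> T'"
          by (auto simp: q_def)
        then have "U \<inter> U' \<in> p" using fp by (auto simp: filter_on_def)
        moreover have "U \<inter> U' \<inter> S \<subseteq> T \<inter> T'" using U by auto
        ultimately show "T \<inter> T' \<in> q" using T by (auto simp: q_def) }
      { fix T' assume "T \<subseteq> T'" "T' \<subseteq> X"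
        then show "T' \<in> q" using T unfolding q_def by blast }
    qed
    moreover have "p \<subseteq> q" using fp by (auto simp: q_def filter_on_def)
    ultimately have "q = p" by (rule mx)
    moreover have "S \<in> q" using S fp by (auto simp: q_def filter_on_def)
    ultimately show ?thesis by simp
  qed
  with fp show "filter_on X p \<and> (\<forall>S\<subseteq>X. S \<in> p \<or> X - S \<in> p)" by blast
next
  assume r: "filter_on X p \<and> (\<forall>S\<subseteq>X. S \<in> p \<or> X - S \<in> p)"
  have "q \<subseteq> p" if q: "filter_on X q" "p \<subseteq> q" for q
  proof
    fix S assume S: "S \<in> q"
    have "X - S \<notin> p"
    proof
      assume "X - S \<in> p"
      then have "S \<inter> (X - S) \<in> q" using q S unfolding filter_on_def by blast
      then show False using q by (auto simp: filter_on_def)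
    qed
    moreover have "S \<subseteq> X" using q(1) S unfolding filter_on_def by blast
    ultimately show "S \<in> p" using r by blast
  qed
  then show "p \<in> beta X" using r unfolding beta_def by blast
qed

lemma topspace_beta_topology [simp]: "topspace (beta_topology X) = beta X"
  unfolding beta_topology_def topology_generated_by_topspace
  by (auto simp: basic_clopen_def beta_def filter_on_def)

lemma principal_on_in_beta: "x \<in> X \<Longrightarrow> principal_on X x \<in> beta X"
  by (auto simp: beta_iff filter_on_def principal_on_def)

lemma beta_map_in_beta:
  assumes h: "h \<in> X \<rightarrow> Z" and p: "p \<in> beta X"
  shows "beta_map X Z h p \<in> beta Z"
proof -
  have fp: "filter_on X p" and up: "\<And>S. S \<subseteq> X \<Longrightarrow> S \<in> p \<or> X - S \<in> p"
    using p by (auto simp: beta_iff)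
  have X: "{x \<in> X. h x \<in> Z} = X" using h by auto
  have I: "{x \<in> X. h x \<in> S \<inter> T} = {x \<in> X. h x \<in> S} \<inter> {x \<in> X. h x \<in> T}" for S T by auto
  have "filter_on Z (beta_map X Z h p)"
    unfolding filter_on_def
  proof (intro conjI ballI allI impI)
    show "beta_map X Z h p \<subseteq> Pow Z" by (auto simp: beta_map_def)
    show "Z \<in> beta_map X Z h p" "{} \<notin> beta_map X Z h p"
      using fp X by (auto simp: beta_map_def filter_on_def)
    fix S assume S: "S \<in> beta_map X Z h p"
    { fix T assume "T \<in> beta_map X Z h p"
      then have "{x \<in> X. h x \<in> S} \<inter> {x \<in> X. h x \<in> T} \<in> p"
        using S fp unfolding beta_map_def filter_on_def by blast
      then show "S \<inter> T \<in> beta_map X Z h p" using S unfolding I[symmetric]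
        by (auto simp: beta_map_def) }
    { fix T assume T: "S \<subseteq> T" "T \<subseteq> Z"
      have "{x \<in> X. h x \<in> S} \<subseteq> {x \<in> X. h x \<in> T}" "{x \<in> X. h x \<in> T} \<subseteq> X" using T by auto
      then have "{x \<in> X. h x \<in> T} \<in> p"
        using S fp unfolding beta_map_def filter_on_def by blast
      then show "T \<in> beta_map X Z h p" using T by (simp add: beta_map_def) }
  qed
  moreover have "S \<in> beta_map X Z h p \<or> Z - S \<in> beta_map X Z h p" if "S \<subseteq> Z" for S
  proof -
    have "X - {x \<in> X. h x \<in> S} = {x \<in> X. h x \<in> Z - S}" using h by auto
    then show ?thesis using up[of "{x \<in> X. h x \<in> S}"] that by (auto simp: beta_map_def)
  qed
  ultimately show ?thesis by (simp add: beta_iff)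
qed

lemma continuous_map_beta_map:
  assumes h: "h \<in> X \<rightarrow> Z"
  shows "continuous_map (beta_topology X) (beta_topology Z) (beta_map X Z h)"
  unfolding beta_topology_def[of Z]
proof (rule continuous_on_generated_topo)
  fix U assume "U \<in> basic_clopen Z ` Pow Z"
  then obtain S where S: "S \<subseteq> Z" "U = basic_clopen Z S" by auto
  have "beta_map X Z h -` U \<inter> topspace (beta_topology X) = basic_clopen X {x \<in> X. h x \<in> S}"
    using S beta_map_in_beta[OF h] by (auto simp: basic_clopen_def beta_map_def)
  then show "openin (beta_topology X) (beta_map X Z h -` U \<inter> topspace (beta_topology X))"
    unfolding beta_topology_def by (auto intro: topology_generated_by_Basis)
next
  show "beta_map X Z h ` topspace (beta_topology X) \<subseteq> \<Union> (basic_clopen Z ` Pow Z)"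
  proof (clarsimp)
    fix p assume "p \<in> beta X"
    then have "beta_map X Z h p \<in> beta Z" by (rule beta_map_in_beta[OF h])
    then show "\<exists>x\<in>Pow Z. beta_map X Z h p \<in> basic_clopen Z x"
      by (intro bexI[of _ Z]) (auto simp: basic_clopen_def beta_iff filter_on_def)
  qed
qed

lemma beta_map_principal:
  assumes "x \<in> X"
  shows "beta_map X Z h (principal_on X x) = principal_on Z (h x)"
  using assms by (auto simp: beta_map_def principal_on_def)

lemma restrict_in_H:
  assumes A: "exhaustion L K A" and mn: "m \<le> n" and x: "x \<in> H L K A n"
  shows "restrict x (universe (A m)) \<in> H L K A m"
proof -
  have s: "substructure L (A m) (A n)" using A mn unfolding exhaustion_def by blast
  then have sub: "universe (A m) \<subseteq> universe (A n)" by (auto simp: substructure_def)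
  have rel: "xs \<in> interp (A m) R \<longleftrightarrow> map (restrict x (universe (A m))) xs \<in> interp K R"
    if R: "R \<in> symbols L" and l: "length xs = arity L R" and xs: "set xs \<subseteq> universe (A m)" for R xs
  proof -
    have "map (restrict x (universe (A m))) xs = map x xs" using xs by auto
    moreover have "xs \<in> interp (A m) R \<longleftrightarrow> xs \<in> interp (A n) R"
      using s R xs by (auto simp: substructure_def)
    moreover have "xs \<in> interp (A n) R \<longleftrightarrow> map x xs \<in> interp K R"
    proof -
      have "set xs \<subseteq> universe (A n)" using xs sub by (rule subset_trans)
      then show ?thesis using x R l unfolding H_def Emb_def by blast
    qed
    ultimately show ?thesis by (simp only:)
  qed
  have "inj_on (restrict x (universe (A m))) (universe (A m))"
  proof -
    have "inj_on x (universe (A n))" using x unfolding H_def Emb_def by blast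
    then have "inj_on x (universe (A m))" using sub by (rule inj_on_subset)
    then show ?thesis by (simp add: inj_on_restrict_eq)
  qed
  moreover have "restrict x (universe (A m)) \<in> universe (A m) \<rightarrow>\<^sub>E universe K"
  proof -
    have "x \<in> universe (A n) \<rightarrow>\<^sub>E universe K" using x unfolding H_def Emb_def by blast
    then show ?thesis using sub by (auto simp: PiE_iff)
  qed
  ultimately show ?thesis using rel unfolding H_def Emb_def by blast
qed

lemma SG_dot_iff:
  fixes A :: "nat \<Rightarrow> ('a, 'r) rel_structure"
  assumes A: "exhaustion L K A" and \<alpha>: "\<alpha> \<in> SG L K A" and S: "S \<subseteq> H L K A m"
    and n: "m \<le> n" "f ` universe (A m) \<subseteq> universe (A n)"
  shows "S \<in> SG_dot L K A m \<alpha> f \<longleftrightarrow>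
    {x \<in> H L K A n. compose (universe (A m)) x f \<in> S} \<in> \<alpha> n"
proof -
  let ?P = "\<lambda>n. {x \<in> H L K A n. compose (universe (A m)) x f \<in> S}"
  have step: "?P k \<in> \<alpha> k \<longleftrightarrow> ?P l \<in> \<alpha> l"
    if kl: "k \<le> l" and f: "f ` universe (A m) \<subseteq> universe (A k)" for k l
  proof -
    have "\<alpha> k = res L K A l k (\<alpha> l)" using \<alpha> kl by (auto simp: SG_def)
    then have "?P k \<in> \<alpha> k \<longleftrightarrow> {x \<in> H L K A l. restrict x (universe (A k)) \<in> ?P k} \<in> \<alpha> l"
      by (auto simp: res_def beta_map_def)
    also have "{x \<in> H L K A l. restrict x (universe (A k)) \<in> ?P k} = ?P l"
    proof -
      have "compose (universe (A m)) (restrict x (universe (A k))) f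
          = compose (universe (A m)) x f" for x :: "'a \<Rightarrow> 'a"
        using f by (auto simp: compose_def fun_eq_iff)
      then show ?thesis using restrict_in_H[OF A kl] by auto
    qed
    finally show ?thesis .
  qed
  have indep: "?P k \<in> \<alpha> k \<longleftrightarrow> ?P n \<in> \<alpha> n" if k: "f ` universe (A m) \<subseteq> universe (A k)" for k
  proof (cases "k \<le> n")
    case True
    then show ?thesis using k by (rule step)
  next
    case False
    then have "n \<le> k" by simp
    from step[OF this n(2)] show ?thesis by (rule sym)
  qed
  show ?thesis
  proof
    assume "S \<in> SG_dot L K A m \<alpha> f"
    then obtain k where "f ` universe (A m) \<subseteq> universe (A k)" "?P k \<in> \<alpha> k"
      unfolding SG_dot_def by blast
    then show "?P n \<in> \<alpha> n" using indep by (simp only:)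
  next
    assume "?P n \<in> \<alpha> n"
    then show "S \<in> SG_dot L K A m \<alpha> f" using S n unfolding SG_dot_def by blast
  qed
qed

end

theory Submission
  imports Defs
begin

text \<open>
  Write \<open>\<chi>\<^sub>T \<cdot> \<alpha>\<close> for the subset \<open>{f. T \<in> \<alpha> \<cdot> f}\<close> of \<open>H\<^sub>m\<close>. The rule \<open>dot_mult\<close>,
  \<open>\<chi>\<^sub>T \<cdot> (\<alpha>\<gamma>) = (\<chi>\<^sub>T \<cdot> \<alpha>) \<cdot> \<gamma>\<close>, says that \<open>S(G)\<close> acts on the right on \<open>2\<^bsup>H\<^sub>m\<^esup>\<close>. The
  orbit of \<open>\<chi>\<^sub>T\<close> under this action is the closure of its \<open>G\<close>-orbit, so \<open>T\<close> is thick iff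
  \<open>\<chi>\<^sub>T \<cdot> v\<close> is all of \<open>H\<^sub>m\<close> for some \<open>v \<in> S(G)\<close> (\<open>Thick_iff_everywhere\<close>; the relation is
  called \<open>everywhere m v T\<close> below). The elements of \<open>S(G)\<close> needed for this and
  below come from ultrafilters on the discrete set \<open>G\<close>: such an ultrafilter has a limit in \<open>S(G)\<close>, and by ultrahomogeneity the
  finite intersection property can be tested on embeddings.

  Let \<open>Y\<close> be a minimal right ideal. The points of \<open>Y\<close> at which \<open>T\<close> holds everywhere form a
  right ideal, hence they are none or all of \<open>Y\<close>; therefore \<open>T \<in> F\<^sub>m\<close> as soon as \<open>T\<close> holds
  everywhere at one point of \<open>Y\<close>. In particular \<open>F\<^sub>m\<close> consists of thick sets. For maximality,
  let \<open>F' \<supseteq> F\<^sub>m\<close> be a filter of thick sets and \<open>T \<in> F'\<close>. Take an idempotent \<open>u \<in> Y\<close>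
  and put \<open>Q = \<chi>\<^sub>T \<cdot> u\<close>. Since \<open>Q \<cdot> u = \<chi>\<^sub>T \<cdot> u\<^sup>2 = \<chi>\<^sub>T \<cdot> u\<close>, the set of \<open>f\<close> on which
  \<open>T\<close> and \<open>Q\<close> agree holds everywhere at \<open>u\<close> and lies in \<open>F\<^sub>m\<close>. Intersected with \<open>T\<close> it is
  thick and contained in \<open>Q\<close>, so \<open>Q\<close> is thick: \<open>Q \<cdot> v\<close> is everything for some \<open>v\<close>. But
  \<open>Q \<cdot> v = \<chi>\<^sub>T \<cdot> (uv)\<close> and \<open>uv \<in> Y\<close>, whence \<open>T \<in> F\<^sub>m\<close>.

  Conversely let all \<open>F\<^sub>m\<close> be maximal. Maximality puts \<open>{x \<in> H\<^sub>n. x \<circ> f \<in> T}\<close> into \<open>F\<^sub>n\<close>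
  whenever \<open>T \<in> F\<^sub>m\<close> (\<open>preimage_in_nbhd_filter\<close>), which says that \<open>T\<close> holds everywhere at each
  point of \<open>Y\<close>; this property passes to right translates, so \<open>Y\<close> is a right ideal. For
  \<open>r, y \<in> Y\<close> the sets holding everywhere at \<open>r\<close> on \<open>H\<^sub>n\<close> form a filter of thick sets above
  \<open>F\<^sub>n\<close>, hence \<open>F\<^sub>n\<close> itself; so no member of \<open>y n\<close> can fail on all of \<open>r \<cdot> H\<^sub>n\<close>, and
  compactness yields \<open>\<gamma>\<close> with \<open>r\<gamma> = y\<close>. Thus each \<open>r \<in> Y\<close> generates \<open>Y\<close>.
\<close>

section \<open>Ultrafilters on a set\<close>

lemma beta_topD: "p \<in> beta X \<Longrightarrow> X \<in> p"
  and beta_subsetD: "p \<in> beta X \<Longrightarrow> S \<in> p \<Longrightarrow> S \<subseteq> X"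
  and beta_Int: "p \<in> beta X \<Longrightarrow> S \<in> p \<Longrightarrow> T \<in> p \<Longrightarrow> S \<inter> T \<in> p"
  and beta_empty: "p \<in> beta X \<Longrightarrow> {} \<notin> p"
  by (auto simp: beta_def filter_on_def)

lemma beta_mono: "p \<in> beta X \<Longrightarrow> S \<in> p \<Longrightarrow> S \<subseteq> T \<Longrightarrow> T \<subseteq> X \<Longrightarrow> T \<in> p"
  unfolding beta_def filter_on_def by blast

lemma beta_compl_iff:
  assumes p: "p \<in> beta X" and S: "S \<subseteq> X"
  shows "X - S \<in> p \<longleftrightarrow> S \<notin> p"
proof -
  have "\<not> (X - S \<in> p \<and> S \<in> p)"
    using beta_Int[OF p, of "X - S" S] beta_empty[OF p] by (auto simp: Int_commute)
  then show ?thesis using p S by (auto simp: beta_iff)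
qed

lemma beta_Int_iff:
  assumes p: "p \<in> beta X" and S: "S \<subseteq> X" "T \<subseteq> X"
  shows "S \<inter> T \<in> p \<longleftrightarrow> S \<in> p \<and> T \<in> p"
proof -
  have "S \<in> p \<and> T \<in> p" if "S \<inter> T \<in> p"
    using beta_mono[OF p that, of S] beta_mono[OF p that, of T] S by blast
  then show ?thesis using beta_Int[OF p] by blast
qed

lemma beta_finite_Inter:
  assumes p: "p \<in> beta X" and fin: "finite I" and B: "\<And>i. i \<in> I \<Longrightarrow> B i \<in> p"
  shows "{x \<in> X. \<forall>i\<in>I. x \<in> B i} \<in> p"
  using fin B
proof (induction I)
  case empty
  then show ?case using beta_topD[OF p] by simp
next
  case (insert i I)
  have "{x \<in> X. \<forall>j\<in>insert i I. x \<in> B j} = B i \<inter> {x \<in> X. \<forall>j\<in>I. x \<in> B j}"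
    using beta_subsetD[OF p, of "B i"] insert.prems by auto
  then show ?case using beta_Int[OF p] insert by simp
qed

lemma beta_eqI:
  assumes "p \<in> beta X" "q \<in> beta X" "p \<subseteq> q"
  shows "p = q"
  using assms unfolding beta_def by blast

text \<open>Used on \<open>X = G\<close>, this produces elements of \<open>S(G)\<close> that meet infinitely many conditions at
  once; it takes the place of compactness of the inverse limit.\<close>

lemma ex_beta_if_fip:
  assumes sub: "\<C> \<subseteq> Pow X"
    and fip: "\<And>\<D>. finite \<D> \<Longrightarrow> \<D> \<subseteq> \<C> \<Longrightarrow> X \<inter> \<Inter>\<D> \<noteq> {}"
  obtains p where "p \<in> beta X" "\<C> \<subseteq> p"
proof -
  define F0 where "F0 = {S. S \<subseteq> X \<and> (\<exists>\<D>. finite \<D> \<and> \<D> \<subseteq> \<C> \<and> X \<inter> \<Inter>\<D> \<subseteq> S)}"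
  have F0: "filter_on X F0"
    unfolding filter_on_def
  proof (intro conjI ballI allI impI)
    show "F0 \<subseteq> Pow X" by (auto simp: F0_def)
    show "X \<in> F0" unfolding F0_def by (auto intro: exI[of _ "{}"])
    show "{} \<notin> F0" using fip unfolding F0_def by auto
    fix S assume S: "S \<in> F0"
    then obtain \<D> where D: "finite \<D>" "\<D> \<subseteq> \<C>" "X \<inter> \<Inter>\<D> \<subseteq> S" "S \<subseteq> X" by (auto simp: F0_def)
    { fix T assume "T \<in> F0"
      then obtain \<E> where E: "finite \<E>" "\<E> \<subseteq> \<C>" "X \<inter> \<Inter>\<E> \<subseteq> T" "T \<subseteq> X" by (auto simp: F0_def)
      have "finite (\<D> \<union> \<E>)" "\<D> \<union> \<E> \<subseteq> \<C>" "X \<inter> \<Inter>(\<D> \<union> \<E>) \<subseteq> S \<inter> T" using D E by auto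
      then show "S \<inter> T \<in> F0" using D(4) unfolding F0_def by blast }
    { fix T assume "S \<subseteq> T" "T \<subseteq> X"
      then have "X \<inter> \<Inter>\<D> \<subseteq> T" "T \<subseteq> X" using D(3) by (auto intro: subset_trans)
      then show "T \<in> F0" using D(1,2) by (auto simp: F0_def) }
  qed
  have CF0: "\<C> \<subseteq> F0"
  proof
    fix S assume "S \<in> \<C>"
    then have "finite {S}" "{S} \<subseteq> \<C>" "X \<inter> \<Inter>{S} \<subseteq> S" "S \<subseteq> X" using sub by auto
    then show "S \<in> F0" unfolding F0_def by blast
  qed
  define \<F> where "\<F> = {F. filter_on X F \<and> F0 \<subseteq> F}"
  have "\<exists>p\<in>\<F>. \<forall>q\<in>\<F>. p \<subseteq> q \<longrightarrow> q = p"
  proof (rule subset_Zorn_nonempty)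
    show "\<F> \<noteq> {}" using F0 by (auto simp: \<F>_def)
    fix \<K> assume K: "\<K> \<noteq> {}" "subset.chain \<F> \<K>"
    then have fil: "\<And>F. F \<in> \<K> \<Longrightarrow> filter_on X F \<and> F0 \<subseteq> F"
      and tot: "\<And>F F'. F \<in> \<K> \<Longrightarrow> F' \<in> \<K> \<Longrightarrow> F \<subseteq> F' \<or> F' \<subseteq> F"
      unfolding subset.chain_def \<F>_def by blast+
    have "filter_on X (\<Union>\<K>)"
      unfolding filter_on_def
    proof (intro conjI ballI allI impI)
      show "\<Union>\<K> \<subseteq> Pow X" "{} \<notin> \<Union>\<K>" using fil unfolding filter_on_def by blast+
      show "X \<in> \<Union>\<K>" using fil K(1) unfolding filter_on_def by blast
      fix S assume S: "S \<in> \<Union>\<K>"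
      { fix T assume T: "T \<in> \<Union>\<K>"
        from S T obtain F F' where "F \<in> \<K>" "F' \<in> \<K>" "S \<in> F" "T \<in> F'" by blast
        then obtain G where "G \<in> \<K>" "S \<in> G" "T \<in> G" using tot by blast
        then show "S \<inter> T \<in> \<Union>\<K>" using fil unfolding filter_on_def by blast }
      { fix T assume "S \<subseteq> T" "T \<subseteq> X"
        then show "T \<in> \<Union>\<K>" using S fil unfolding filter_on_def by blast }
    qed
    moreover have "F0 \<subseteq> \<Union>\<K>" using K(1) fil by blast
    ultimately show "\<Union>\<K> \<in> \<F>" by (simp add: \<F>_def)
  qed
  then obtain p where p: "p \<in> \<F>" and max: "\<And>q. q \<in> \<F> \<Longrightarrow> p \<subseteq> q \<Longrightarrow> q = p" by blast
  have "p \<in> beta X" using p max unfolding beta_def \<F>_def by auto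
  moreover have "\<C> \<subseteq> p" using p CF0 by (auto simp: \<F>_def)
  ultimately show ?thesis by (rule that)
qed

lemma beta_map_iff: "S \<in> beta_map X Z h p \<longleftrightarrow> S \<subseteq> Z \<and> {x \<in> X. h x \<in> S} \<in> p"
  by (simp add: beta_map_def)

text \<open>The basic clopen sets, given only as generators, are a basis: they are closed under
  finite intersection.\<close>

lemma openin_beta_topology_basis:
  assumes U: "openin (beta_topology X) U" and p: "p \<in> U"
  obtains T where "T \<subseteq> X" "T \<in> p" "basic_clopen X T \<subseteq> U"
proof -
  have "generate_topology_on (basic_clopen X ` Pow X) U"
    using U by (simp add: beta_topology_def openin_topology_generated_by_iff)
  then have "\<forall>p\<in>U. \<exists>T. T \<subseteq> X \<and> T \<in> p \<and> basic_clopen X T \<subseteq> U"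
  proof (induction rule: generate_topology_on.induct)
    case Empty
    then show ?case by simp
  next
    case (Int U V)
    show ?case
    proof
      fix p assume "p \<in> U \<inter> V"
      then have pU: "p \<in> U" and pV: "p \<in> V" by auto
      obtain S where S: "S \<subseteq> X" "S \<in> p" "basic_clopen X S \<subseteq> U"
        using bspec[OF Int.IH(1) pU] by blast
      obtain T where T: "T \<subseteq> X" "T \<in> p" "basic_clopen X T \<subseteq> V"
        using bspec[OF Int.IH(2) pV] by blast
      have pX: "p \<in> beta X"
      proof -
        have "openin (beta_topology X) U"
          using Int by (simp add: beta_topology_def openin_topology_generated_by_iff)
        then have "U \<subseteq> beta X" using openin_subset by fastforce
        then show ?thesis using \<open>p \<in> U \<inter> V\<close> by blast
      qed
      have "basic_clopen X (S \<inter> T) \<subseteq> U \<inter> V"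
        using S T by (auto simp: basic_clopen_def beta_Int_iff)
      then show "\<exists>T. T \<subseteq> X \<and> T \<in> p \<and> basic_clopen X T \<subseteq> U \<inter> V"
        using beta_Int[OF pX S(2) T(2)] S(1) by (metis le_infI1)
    qed
  next
    case (UN \<U>)
    show ?case
    proof
      fix p assume "p \<in> \<Union>\<U>"
      then obtain V where V: "V \<in> \<U>" "p \<in> V" by (rule UnionE)
      obtain T where "T \<subseteq> X" "T \<in> p" "basic_clopen X T \<subseteq> V"
        using bspec[OF UN.IH[OF V(1)] V(2)] by (elim exE conjE)
      moreover have "V \<subseteq> \<Union>\<U>" using V(1) by (rule Union_upper)
      ultimately show "\<exists>T. T \<subseteq> X \<and> T \<in> p \<and> basic_clopen X T \<subseteq> \<Union>\<U>"
        using subset_trans by (intro exI[of _ T] conjI)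
    qed
  next
    case (Basis B)
    then show ?case by (auto simp: basic_clopen_def)
  qed
  then show ?thesis using p that by blast
qed

lemma openin_basic_clopen: "T \<subseteq> X \<Longrightarrow> openin (beta_topology X) (basic_clopen X T)"
  unfolding beta_topology_def by (auto intro: topology_generated_by_Basis)

lemma Hausdorff_beta_topology: "Hausdorff_space (beta_topology X)"
  unfolding Hausdorff_space_def
proof (intro allI impI)
  fix p q assume pq: "p \<in> topspace (beta_topology X) \<and> q \<in> topspace (beta_topology X) \<and> p \<noteq> q"
  then have b: "p \<in> beta X" "q \<in> beta X" by auto
  then obtain T where T: "T \<in> p" "T \<notin> q" using pq beta_eqI by blast
  then have TX: "T \<subseteq> X" using b beta_subsetD by blast
  have "X - T \<in> q" using T TX b by (simp add: beta_compl_iff)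
  moreover have "disjnt (basic_clopen X T) (basic_clopen X (X - T))"
    using TX by (auto simp: disjnt_def basic_clopen_def beta_compl_iff)
  ultimately show "\<exists>U V. openin (beta_topology X) U \<and> openin (beta_topology X) V \<and>
      p \<in> U \<and> q \<in> V \<and> disjnt U V"
    using b T TX openin_basic_clopen[of T X] openin_basic_clopen[of "X - T" X]
    by (intro exI[of _ "basic_clopen X T"] exI[of _ "basic_clopen X (X - T)"])
      (auto simp: basic_clopen_def)
qed

lemma mem_closed_iff_nbhd_filter_subset:
  assumes Y: "closedin (beta_topology X) Y" and p: "p \<in> beta X"
  shows "p \<in> Y \<longleftrightarrow> nbhd_filter X Y \<subseteq> p"
proof
  assume "p \<in> Y"
  then show "nbhd_filter X Y \<subseteq> p" by (auto simp: nbhd_filter_def basic_clopen_def)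
next
  assume sub: "nbhd_filter X Y \<subseteq> p"
  show "p \<in> Y"
  proof (rule ccontr)
    assume "p \<notin> Y"
    moreover have YX: "Y \<subseteq> beta X" using closedin_subset[OF Y] by simp
    moreover have "openin (beta_topology X) (beta X - Y)" using Y by (simp add: closedin_def)
    ultimately obtain T where T: "T \<subseteq> X" "T \<in> p" "basic_clopen X T \<subseteq> beta X - Y"
      using p openin_beta_topology_basis by (metis DiffI)
    have "Y \<subseteq> basic_clopen X (X - T)"
    proof
      fix q assume "q \<in> Y"
      then have "q \<in> beta X" "q \<notin> basic_clopen X T" using T YX by auto
      then show "q \<in> basic_clopen X (X - T)"
        using T(1) by (simp add: basic_clopen_def beta_compl_iff)
    qed
    then have "X - T \<in> p" using sub by (auto simp: nbhd_filter_def)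
    then show False using T p by (simp add: beta_compl_iff)
  qed
qed

lemma filter_on_nbhd_filter:
  assumes "Y \<subseteq> beta X" and "Y \<noteq> {}"
  shows "filter_on X (nbhd_filter X Y)"
  unfolding filter_on_def
proof (intro conjI ballI allI impI)
  show "nbhd_filter X Y \<subseteq> Pow X" by (auto simp: nbhd_filter_def)
  show "X \<in> nbhd_filter X Y"
    using assms(1) by (auto simp: nbhd_filter_def basic_clopen_def beta_topD)
  show "{} \<notin> nbhd_filter X Y"
    using assms by (auto simp: nbhd_filter_def basic_clopen_def beta_empty)
  fix S assume S: "S \<in> nbhd_filter X Y"
  { fix T assume "T \<in> nbhd_filter X Y"
    then show "S \<inter> T \<in> nbhd_filter X Y"
      using S by (auto simp: nbhd_filter_def basic_clopen_def intro: beta_Int) }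
  { fix T assume "S \<subseteq> T" "T \<subseteq> X"
    then show "T \<in> nbhd_filter X Y"
      using S unfolding nbhd_filter_def basic_clopen_def by (blast intro: beta_mono) }
qed

text \<open>The form in which maximality is used: the sets containing some \<open>U \<inter> B\<close> with \<open>U \<in> F\<close> form
  a filter inside \<open>\<T>\<close> that extends \<open>F\<close>.\<close>

lemma beta_family_memI:
  assumes F: "F \<in> beta_family X \<T>"
    and up: "\<And>S T. S \<in> \<T> \<Longrightarrow> S \<subseteq> T \<Longrightarrow> T \<subseteq> X \<Longrightarrow> T \<in> \<T>" and ne: "{} \<notin> \<T>"
    and B: "B \<subseteq> X" and meet: "\<And>U. U \<in> F \<Longrightarrow> U \<inter> B \<in> \<T>"
  shows "B \<in> F"
proof -
  define F' where "F' = {T. T \<subseteq> X \<and> (\<exists>U\<in>F. U \<inter> B \<subseteq> T)}"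
  have fF: "filter_on X F" and max: "\<And>F'. family_filter X \<T> F' \<Longrightarrow> F \<subseteq> F' \<Longrightarrow> F' = F"
    using F by (auto simp: beta_family_def family_filter_def)
  have F'T: "F' \<subseteq> \<T>" using up meet unfolding F'_def by blast
  have "filter_on X F'"
    unfolding filter_on_def
  proof (intro conjI ballI allI impI)
    show "F' \<subseteq> Pow X" by (auto simp: F'_def)
    show "X \<in> F'" using fF by (auto simp: F'_def filter_on_def)
    show "{} \<notin> F'" using F'T ne by blast
    fix S assume S: "S \<in> F'"
    then obtain U where U: "U \<in> F" "U \<inter> B \<subseteq> S" "S \<subseteq> X" by (auto simp: F'_def)
    { fix T assume "T \<in> F'"
      then obtain V where V: "V \<in> F" "V \<inter> B \<subseteq> T" by (auto simp: F'_def)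
      have "U \<inter> V \<in> F" using U V fF by (auto simp: filter_on_def)
      moreover have "(U \<inter> V) \<inter> B \<subseteq> S \<inter> T" using U V by auto
      ultimately show "S \<inter> T \<in> F'" using U unfolding F'_def by blast }
    { fix T assume "S \<subseteq> T" "T \<subseteq> X"
      then show "T \<in> F'" using U unfolding F'_def by blast }
  qed
  moreover have "F \<subseteq> F'" using fF by (auto simp: F'_def filter_on_def)
  ultimately have "F' = F" using F'T max by (simp add: family_filter_def)
  moreover have "B \<in> F'" using fF B by (auto simp: F'_def filter_on_def)
  ultimately show ?thesis by simp
qed


section \<open>Idempotents in compact left-topological semigroups\<close>

text \<open>The Ellis-Numakura lemma. In a minimal closed subsemigroup \<open>P\<close> any \<open>u\<close> is idempotent:
  \<open>uP\<close> is a closed subsemigroup, so \<open>uP = P\<close> and \<open>{a \<in> P. ua = u}\<close> is nonempty; this again is a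
  closed subsemigroup, so it is \<open>P\<close> and contains \<open>u\<close>.\<close>

lemma ex_idempotent:
  assumes H: "Hausdorff_space X" and Y: "compactin X Y" and ne: "Y \<noteq> {}"
    and closed: "\<And>a b. a \<in> Y \<Longrightarrow> b \<in> Y \<Longrightarrow> mul a b \<in> Y"
    and assoc: "\<And>a b c. a \<in> Y \<Longrightarrow> b \<in> Y \<Longrightarrow> c \<in> Y \<Longrightarrow> mul (mul a b) c = mul a (mul b c)"
    and cont: "\<And>a. a \<in> Y \<Longrightarrow> continuous_map (subtopology X Y) X (mul a)"
  obtains u where "u \<in> Y" "mul u u = u"
proof -
  define \<S> where "\<S> = {P. P \<noteq> {} \<and> P \<subseteq> Y \<and> closedin X P \<and> (\<forall>a\<in>P. \<forall>b\<in>P. mul a b \<in> P)}"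
  have "\<exists>P\<in>\<S>. \<forall>Q\<in>\<S>. Q \<subseteq> P \<longrightarrow> Q = P"
  proof -
    (* Zorn's lemma yields maximal sets, hence the passage to complements. *)
    have "\<exists>M\<in>uminus ` \<S>. \<forall>Q\<in>uminus ` \<S>. M \<subseteq> Q \<longrightarrow> Q = M"
    proof (rule subset_Zorn_nonempty)
      have "Y \<in> \<S>" using ne closed compactin_imp_closedin[OF H Y] by (auto simp: \<S>_def)
      then show "uminus ` \<S> \<noteq> {}" by blast
      fix \<K> assume K: "\<K> \<noteq> {}" "subset.chain (uminus ` \<S>) \<K>"
      define \<J> where "\<J> = uminus ` \<K>"
      have J: "\<J> \<subseteq> \<S>" "\<J> \<noteq> {}" using K unfolding \<J>_def subset.chain_def by auto
      have tot: "P \<subseteq> Q \<or> Q \<subseteq> P" if PQ: "P \<in> \<J>" "Q \<in> \<J>" for P Q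
      proof -
        have "- P \<in> \<K>" "- Q \<in> \<K>" using PQ by (auto simp: \<J>_def)
        then have "- P \<subseteq> - Q \<or> - Q \<subseteq> - P" using K(2) unfolding subset.chain_def by blast
        then show ?thesis by blast
      qed
      have "\<Inter>\<J> \<in> \<S>"
      proof -
        have "Y \<inter> \<Inter>\<J> \<noteq> {}"
        proof -
          have "\<exists>P\<in>\<J>. P \<subseteq> \<Inter>\<D>" if "finite \<D>" "\<D> \<subseteq> \<J>" for \<D>
            using that
          proof (induction \<D>)
            case empty
            then show ?case using J by auto
          next
            case (insert Q \<D>)
            then obtain P where "P \<in> \<J>" "P \<subseteq> \<Inter>\<D>" by auto
            moreover have "Q \<in> \<J>" using insert by simp
            ultimately show ?case using tot[of P Q] by (auto simp only: Inter_insert Int_subset_iff)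
          qed
          moreover have "P \<noteq> {}" "P \<subseteq> Y" if "P \<in> \<J>" for P using that J by (auto simp: \<S>_def)
          ultimately have "Y \<inter> \<Inter>\<D> \<noteq> {}" if "finite \<D>" "\<D> \<subseteq> \<J>" for \<D>
            using that by (metis Int_greatest subset_empty)
          moreover have "\<forall>C\<in>\<J>. closedin X C" using J by (auto simp: \<S>_def)
          ultimately show ?thesis using Y unfolding compactin_fip by blast
        qed
        moreover have "closedin X (\<Inter>\<J>)" using J by (intro closedin_Inter) (auto simp: \<S>_def)
        moreover have "\<Inter>\<J> \<subseteq> Y" using J unfolding \<S>_def by blast
        moreover have "\<forall>a\<in>\<Inter>\<J>. \<forall>b\<in>\<Inter>\<J>. mul a b \<in> \<Inter>\<J>" using J unfolding \<S>_def by blast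
        ultimately show ?thesis unfolding \<S>_def by blast
      qed
      moreover have "\<Union>\<K> = - \<Inter>\<J>" by (auto simp: \<J>_def)
      ultimately show "\<Union>\<K> \<in> uminus ` \<S>" by blast
    qed
    then obtain P where "P \<in> \<S>" and max: "\<And>Q. Q \<in> \<S> \<Longrightarrow> - P \<subseteq> - Q \<Longrightarrow> - Q = - P"
      by (auto simp del: Compl_subset_Compl_iff Compl_eq_Compl_iff)
    moreover have "Q = P" if "Q \<in> \<S>" "Q \<subseteq> P" for Q using max[OF that(1)] that(2) by simp
    ultimately show ?thesis by blast
  qed
  then obtain P where P: "P \<in> \<S>" and min: "\<And>Q. Q \<in> \<S> \<Longrightarrow> Q \<subseteq> P \<Longrightarrow> Q = P" by blast
  then obtain u where u: "u \<in> P" by (auto simp: \<S>_def)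
  have PY: "P \<subseteq> Y" and Pcl: "closedin X P" and Pm: "\<And>a b. a \<in> P \<Longrightarrow> b \<in> P \<Longrightarrow> mul a b \<in> P"
    using P by (auto simp: \<S>_def)
  have uY: "u \<in> Y" using u PY by blast
  have Pc: "compactin X P" using closed_compactin[OF Y PY Pcl] .
  have "mul u ` P \<in> \<S>"
  proof -
    have "compactin (subtopology X Y) P" using Pc PY by (simp add: compactin_subtopology)
    then have "compactin X (mul u ` P)" using cont[OF uY] by (rule image_compactin)
    then have "closedin X (mul u ` P)" using H by (simp add: compactin_imp_closedin)
    moreover have "mul (mul u a) (mul u b) \<in> mul u ` P" if "a \<in> P" "b \<in> P" for a b
    proof -
      have "mul (mul u a) (mul u b) = mul u (mul a (mul u b))"
        using that u PY Pm by (intro assoc) auto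
      then show ?thesis using that u Pm by simp
    qed
    moreover have "mul u ` P \<subseteq> Y" using PY Pm u by blast
    moreover have "mul u ` P \<noteq> {}" using u by blast
    ultimately show ?thesis unfolding \<S>_def by simp
  qed
  moreover have "mul u ` P \<subseteq> P" using u Pm by blast
  ultimately have "mul u ` P = P" by (rule min)
  then obtain e where e: "e \<in> P" "mul u e = u" using u by (metis imageE)
  define Q where "Q = {a \<in> P. mul u a = u}"
  have "Q \<in> \<S>"
  proof -
    have "closedin (subtopology X Y) {a \<in> topspace (subtopology X Y). mul u a \<in> {u}}"
    proof (rule closedin_continuous_map_preimage[OF cont[OF uY]])
      show "closedin X {u}"
        using uY compactin_subset_topspace[OF Y] Hausdorff_imp_t1_space[OF H]
        by (simp add: t1_space_closedin_singleton subset_iff)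
    qed
    moreover have "{a \<in> topspace (subtopology X Y). mul u a \<in> {u}} = {a \<in> Y. mul u a = u}"
      using compactin_subset_topspace[OF Y] by auto
    ultimately have "closedin X {a \<in> Y. mul u a = u}"
      using compactin_imp_closedin[OF H Y] closedin_trans_full by metis
    then have "closedin X ({a \<in> Y. mul u a = u} \<inter> P)" using Pcl by (rule closedin_Int)
    moreover have "{a \<in> Y. mul u a = u} \<inter> P = Q" using PY by (auto simp: Q_def)
    ultimately have "closedin X Q" by simp
    moreover have "mul a b \<in> Q" if "a \<in> Q" "b \<in> Q" for a b
    proof -
      have "mul u (mul a b) = mul (mul u a) b"
        using that uY PY by (intro assoc[symmetric]) (auto simp: Q_def)
      then show ?thesis using that Pm by (auto simp: Q_def)
    qed
    moreover have "Q \<noteq> {}" using e by (auto simp: Q_def)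
    moreover have "Q \<subseteq> Y" using PY by (auto simp: Q_def)
    ultimately show ?thesis by (simp add: \<S>_def)
  qed
  then have "Q = P" by (rule min) (auto simp: Q_def)
  then have "mul u u = u" using u by (auto simp: Q_def)
  with uY show ?thesis by (rule that)
qed


section \<open>Embeddings and automorphisms\<close>

locale fraisse_exhaustion =
  fixes L :: "'r language"
    and K :: "('a, 'r) rel_structure"
    and A :: "nat \<Rightarrow> ('a, 'r) rel_structure"
  assumes fraisse: "fraisse_structure L K"
    and exhaustion: "exhaustion L K A"
begin

abbreviation U :: "nat \<Rightarrow> 'a set" where "U n \<equiv> universe (A n)"
abbreviation Hn :: "nat \<Rightarrow> ('a \<Rightarrow> 'a) set" where "Hn n \<equiv> H L K A n"
abbreviation G :: "('a \<Rightarrow> 'a) set" where "G \<equiv> Aut L K"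
abbreviation S\<^sub>G :: "(nat \<Rightarrow> ('a \<Rightarrow> 'a) set set) set" where "S\<^sub>G \<equiv> SG L K A"
abbreviation dot :: "nat \<Rightarrow> (nat \<Rightarrow> ('a \<Rightarrow> 'a) set set) \<Rightarrow> ('a \<Rightarrow> 'a) \<Rightarrow> ('a \<Rightarrow> 'a) set set"
  where "dot m \<alpha> f \<equiv> SG_dot L K A m \<alpha> f"
abbreviation mult (infixl "\<star>" 70) where "\<alpha> \<star> \<gamma> \<equiv> SG_mult L K A \<alpha> \<gamma>"

lemma U_mono: "m \<le> n \<Longrightarrow> U m \<subseteq> U n"
  and finite_U: "finite (U n)"
  and U_subset: "U n \<subseteq> universe K"
  and U_Union: "universe K = (\<Union>n. U n)"
  and substructure_A: "substructure L (A n) K"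
  using exhaustion unfolding exhaustion_def by (auto simp: substructure_def)

lemma HnI:
  assumes "x \<in> U n \<rightarrow>\<^sub>E universe K" "inj_on x (U n)"
    and "\<And>R xs. R \<in> symbols L \<Longrightarrow> length xs = arity L R \<Longrightarrow> set xs \<subseteq> U n \<Longrightarrow>
           xs \<in> interp K R \<longleftrightarrow> map x xs \<in> interp K R"
  shows "x \<in> Hn n"
  using assms substructure_A[of n] unfolding H_def Emb_def substructure_def by auto

lemma HnD:
  assumes "x \<in> Hn n"
  shows "x \<in> U n \<rightarrow>\<^sub>E universe K" "inj_on x (U n)"
    and "\<And>R xs. R \<in> symbols L \<Longrightarrow> length xs = arity L R \<Longrightarrow> set xs \<subseteq> U n \<Longrightarrow>
           xs \<in> interp K R \<longleftrightarrow> map x xs \<in> interp K R"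
  using assms substructure_A[of n] unfolding H_def Emb_def substructure_def by auto

lemma GD:
  assumes "g \<in> G"
  shows "g \<in> universe K \<rightarrow> universe K" "inj_on g (universe K)"
    and "\<And>R xs. R \<in> symbols L \<Longrightarrow> length xs = arity L R \<Longrightarrow> set xs \<subseteq> universe K \<Longrightarrow>
           xs \<in> interp K R \<longleftrightarrow> map g xs \<in> interp K R"
  using assms unfolding Aut_def Iso_def Emb_def by auto

lemma Hn_image_subset: "x \<in> Hn n \<Longrightarrow> x ` U n \<subseteq> universe K"
  using HnD(1) by fastforce

lemma compose_Hn:
  assumes x: "x \<in> Hn n" and f: "f \<in> Hn m" and ran: "f ` U m \<subseteq> U n"
  shows "compose (U m) x f \<in> Hn m"
proof (rule HnI)
  show "compose (U m) x f \<in> U m \<rightarrow>\<^sub>E universe K"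
    using HnD(1)[OF x] ran by (auto simp: compose_def)
  show "inj_on (compose (U m) x f) (U m)"
    using HnD(2)[OF x] HnD(2)[OF f] ran
    by (auto simp: inj_on_def compose_def image_subset_iff)
  fix R xs assume R: "R \<in> symbols L" "length xs = arity L R" "set xs \<subseteq> U m"
  have eq: "map (compose (U m) x f) xs = map x (map f xs)" using R(3) by (auto simp: compose_def)
  have "set (map f xs) \<subseteq> U n" using R(3) ran by auto
  then show "xs \<in> interp K R \<longleftrightarrow> map (compose (U m) x f) xs \<in> interp K R"
    using HnD(3)[OF f R] HnD(3)[OF x R(1), of "map f xs"] R(2) unfolding eq by simp
qed

lemma compose_G:
  assumes g: "g \<in> G" and f: "f \<in> Hn m"
  shows "compose (U m) g f \<in> Hn m"
proof (rule HnI)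
  have ran: "f ` U m \<subseteq> universe K" using f by (rule Hn_image_subset)
  show "compose (U m) g f \<in> U m \<rightarrow>\<^sub>E universe K"
    using GD(1)[OF g] ran by (auto simp: compose_def)
  show "inj_on (compose (U m) g f) (U m)"
    using GD(2)[OF g] HnD(2)[OF f] ran
    by (auto simp: inj_on_def compose_def image_subset_iff)
  fix R xs assume R: "R \<in> symbols L" "length xs = arity L R" "set xs \<subseteq> U m"
  have eq: "map (compose (U m) g f) xs = map g (map f xs)" using R(3) by (auto simp: compose_def)
  have "set (map f xs) \<subseteq> universe K" using R(3) ran by auto
  then show "xs \<in> interp K R \<longleftrightarrow> map (compose (U m) g f) xs \<in> interp K R"
    using HnD(3)[OF f R] GD(3)[OF g R(1), of "map f xs"] R(2) unfolding eq by simp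
qed

lemma id_Hn: "restrict id (U m) \<in> Hn m"
proof (rule HnI)
  show "restrict id (U m) \<in> U m \<rightarrow>\<^sub>E universe K" using U_subset[of m] by auto
  show "inj_on (restrict id (U m)) (U m)" by (simp add: inj_on_def)
  fix R xs assume "set xs \<subseteq> U m"
  then have "map (restrict id (U m)) xs = xs" by (intro map_idI) auto
  then show "xs \<in> interp K R \<longleftrightarrow> map (restrict id (U m)) xs \<in> interp K R" by simp
qed

lemma compose_id: "compose (U m) x (restrict id (U m)) = restrict x (U m)"
  by (auto simp: compose_def)

lemma restrict_G: "g \<in> G \<Longrightarrow> restrict g (U n) \<in> Hn n"
  using compose_G[OF _ id_Hn] by (simp add: compose_id)

lemma restrict_Hn_self: "x \<in> Hn n \<Longrightarrow> restrict x (U n) = x"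
  using HnD(1) by (metis PiE_restrict)

text \<open>Ultrahomogeneity, applied to \<open>A n\<close> and its image under \<open>x\<close>.\<close>

lemma extend_to_G:
  assumes x: "x \<in> Hn n"
  obtains g where "g \<in> G" "restrict g (U n) = x"
proof -
  define B where "B = \<lparr>universe = x ` U n, interp = (\<lambda>R. {xs \<in> interp K R. set xs \<subseteq> x ` U n})\<rparr>"
  have B: "substructure L B K" "finite (universe B)"
    using Hn_image_subset[OF x] finite_U by (auto simp: substructure_def B_def)
  have "xs \<in> interp (A n) R \<longleftrightarrow> map x xs \<in> interp B R"
    if R: "R \<in> symbols L" "length xs = arity L R" "set xs \<subseteq> U n" for R xs
  proof -
    have "xs \<in> interp (A n) R \<longleftrightarrow> xs \<in> interp K R"
      using substructure_A[of n] R by (auto simp: substructure_def)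
    then show ?thesis using HnD(3)[OF x R] R(3) by (auto simp: B_def)
  qed
  then have "x \<in> Iso L (A n) B"
    using HnD(1,2)[OF x] by (auto simp: Iso_def Emb_def B_def)
  moreover have "ultrahomogeneous L K" using fraisse by (simp add: fraisse_structure_def)
  ultimately obtain g where "g \<in> G" "\<forall>a\<in>U n. g a = x a"
    using B substructure_A[of n] finite_U[of n] unfolding ultrahomogeneous_def by blast
  moreover from this have "restrict g (U n) = restrict x (U n)" by auto
  ultimately show ?thesis using that restrict_Hn_self[OF x] by metis
qed

lemma finite_subset_U:
  assumes "finite S" "S \<subseteq> universe K"
  obtains n where "N \<le> n" "S \<subseteq> U n"
proof -
  have "\<exists>n\<ge>N. S \<subseteq> U n" using assms
  proof (induction S)
    case empty
    then show ?case by auto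
  next
    case (insert a S)
    then obtain n k where nk: "N \<le> n" "S \<subseteq> U n" "a \<in> U k" using U_Union by auto
    have "insert a S \<subseteq> U (max n k)" using nk U_mono[of n "max n k"] U_mono[of k "max n k"] by auto
    then show ?case using nk by (meson le_trans max.cobounded1)
  qed
  then show ?thesis using that by blast
qed

lemma Hn_range_subset:
  assumes "finite E" "E \<subseteq> Hn m"
  obtains n where "N \<le> n" "\<And>f. f \<in> E \<Longrightarrow> f ` U m \<subseteq> U n"
proof -
  have "finite (\<Union>f\<in>E. f ` U m)" using assms(1) finite_U by auto
  moreover have "(\<Union>f\<in>E. f ` U m) \<subseteq> universe K" using assms(2) Hn_image_subset by blast
  ultimately obtain n where "N \<le> n" "(\<Union>f\<in>E. f ` U m) \<subseteq> U n" by (rule finite_subset_U)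
  then show ?thesis using that by blast
qed

lemma Hn_range_subset1:
  assumes "f \<in> Hn m"
  obtains n where "N \<le> n" "f ` U m \<subseteq> U n"
  using Hn_range_subset[of "{f}" m N] assms by auto

lemma compose_restrict:
  "f ` U m \<subseteq> U n \<Longrightarrow> compose (U m) (restrict x (U n)) f = compose (U m) x f"
  by (auto simp: compose_def fun_eq_iff)

lemma compose_compose:
  "compose (U m) z (compose (U m) x f) = compose (U m) (compose (U n) z x) f" if "f ` U m \<subseteq> U n"
  using that by (auto simp: compose_def fun_eq_iff)


section \<open>The semigroup\<close>

lemma SG_beta: "\<alpha> \<in> S\<^sub>G \<Longrightarrow> \<alpha> n \<in> beta (Hn n)"
  by (simp add: SG_def)

lemma SG_restrict_iff:
  assumes "\<alpha> \<in> S\<^sub>G" "m \<le> n" "S \<subseteq> Hn m"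
  shows "{x \<in> Hn n. restrict x (U m) \<in> S} \<in> \<alpha> n \<longleftrightarrow> S \<in> \<alpha> m"
proof -
  have "res L K A n m (\<alpha> n) = \<alpha> m" using assms by (simp add: SG_def)
  then show ?thesis using assms(3) by (auto simp: res_def beta_map_def)
qed

lemma dot_eq_beta_map:
  assumes \<alpha>: "\<alpha> \<in> S\<^sub>G" and f: "f \<in> Hn m" and n: "m \<le> n" "f ` U m \<subseteq> U n"
  shows "dot m \<alpha> f = beta_map (Hn n) (Hn m) (\<lambda>x. compose (U m) x f) (\<alpha> n)"
proof (intro set_eqI)
  fix S show "S \<in> dot m \<alpha> f \<longleftrightarrow> S \<in> beta_map (Hn n) (Hn m) (\<lambda>x. compose (U m) x f) (\<alpha> n)"
  proof (cases "S \<subseteq> Hn m")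
    case True
    then show ?thesis using SG_dot_iff[OF exhaustion \<alpha> True n] by (simp add: beta_map_iff)
  next
    case False
    then show ?thesis by (auto simp: SG_dot_def beta_map_iff)
  qed
qed

lemma dot_in_beta:
  assumes \<alpha>: "\<alpha> \<in> S\<^sub>G" and f: "f \<in> Hn m"
  shows "dot m \<alpha> f \<in> beta (Hn m)"
proof -
  obtain n where n: "m \<le> n" "f ` U m \<subseteq> U n" using f by (rule Hn_range_subset1)
  show ?thesis unfolding dot_eq_beta_map[OF \<alpha> f n]
    using compose_Hn[OF _ f n(2)] SG_beta[OF \<alpha>] by (intro beta_map_in_beta) auto
qed

text \<open>Moves a composition out of the action. With \<open>f\<close> an inclusion this compares the action on an
  embedding with the action on its restrictions.\<close>

lemma dot_compose:
  assumes \<alpha>: "\<alpha> \<in> S\<^sub>G" and x: "x \<in> Hn n" and f: "f \<in> Hn m" and ran: "f ` U m \<subseteq> U n"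
    and S: "S \<subseteq> Hn m"
  shows "S \<in> dot m \<alpha> (compose (U m) x f) \<longleftrightarrow> {z \<in> Hn n. compose (U m) z f \<in> S} \<in> dot n \<alpha> x"
proof -
  obtain k where k: "max m n \<le> k" "x ` U n \<subseteq> U k" using x by (rule Hn_range_subset1)
  have xf: "compose (U m) x f ` U m \<subseteq> U k" using k ran by (auto simp: compose_def)
  have "S \<in> dot m \<alpha> (compose (U m) x f) \<longleftrightarrow>
      {z \<in> Hn k. compose (U m) z (compose (U m) x f) \<in> S} \<in> \<alpha> k"
    using k xf by (intro SG_dot_iff[OF exhaustion \<alpha> S]) auto
  also have "{z \<in> Hn k. compose (U m) z (compose (U m) x f) \<in> S} =
      {z \<in> Hn k. compose (U n) z x \<in> {z \<in> Hn n. compose (U m) z f \<in> S}}"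
    using compose_Hn[OF _ x k(2)] by (auto simp: compose_compose[OF ran])
  also have "\<dots> \<in> \<alpha> k \<longleftrightarrow> {z \<in> Hn n. compose (U m) z f \<in> S} \<in> dot n \<alpha> x"
    using k by (intro SG_dot_iff[OF exhaustion \<alpha>, symmetric]) auto
  finally show ?thesis .
qed

lemma dot_restrict:
  assumes \<alpha>: "\<alpha> \<in> S\<^sub>G" and x: "x \<in> Hn n" and mn: "m \<le> n" and S: "S \<subseteq> Hn m"
  shows "S \<in> dot m \<alpha> (restrict x (U m)) \<longleftrightarrow> {z \<in> Hn n. restrict z (U m) \<in> S} \<in> dot n \<alpha> x"
proof -
  have "restrict id (U m) ` U m \<subseteq> U n" using U_mono[OF mn] by auto
  from dot_compose[OF \<alpha> x id_Hn this S] show ?thesis by (simp only: compose_id)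
qed

lemma dot_id: 
  assumes \<alpha>: "\<alpha> \<in> S\<^sub>G"
  shows "dot m \<alpha> (restrict id (U m)) = \<alpha> m"
proof (intro set_eqI)
  fix S
  show "S \<in> dot m \<alpha> (restrict id (U m)) \<longleftrightarrow> S \<in> \<alpha> m"
  proof (cases "S \<subseteq> Hn m")
    case True
    have "{x \<in> Hn m. compose (U m) x (restrict id (U m)) \<in> S} = S"
      using True restrict_Hn_self by (auto simp: compose_id)
    moreover have "restrict id (U m) ` U m \<subseteq> U m" by auto
    ultimately show ?thesis using SG_dot_iff[OF exhaustion \<alpha> True order_refl, of "restrict id (U m)"] by simp
  next
    case False
    then show ?thesis using beta_subsetD[OF SG_beta[OF \<alpha>]] by (auto simp: SG_dot_def)
  qed
qed

lemma mult_iff: "S \<in> (\<alpha> \<star> \<gamma>) m \<longleftrightarrow> S \<subseteq> Hn m \<and> {f \<in> Hn m. S \<in> dot m \<alpha> f} \<in> \<gamma> m"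
  by (simp add: SG_mult_def)

lemma mult_closed:
  assumes \<alpha>: "\<alpha> \<in> S\<^sub>G" and \<gamma>: "\<gamma> \<in> S\<^sub>G"
  shows "\<alpha> \<star> \<gamma> \<in> S\<^sub>G"
proof -
  note b = SG_beta[OF \<gamma>]
  have "(\<alpha> \<star> \<gamma>) m \<in> beta (Hn m)" for m
    unfolding beta_iff filter_on_def
  proof (intro conjI ballI allI impI)
    let ?D = "\<lambda>S. {f \<in> Hn m. S \<in> dot m \<alpha> f}"
    note d = dot_in_beta[OF \<alpha>, of _ m]
    show "(\<alpha> \<star> \<gamma>) m \<subseteq> Pow (Hn m)" by (auto simp: mult_iff)
    have "?D (Hn m) = Hn m" using beta_topD[OF d] by auto
    then show "Hn m \<in> (\<alpha> \<star> \<gamma>) m" using beta_topD[OF b[of m]] by (simp add: mult_iff)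
    have "?D {} = {}" using beta_empty[OF d] by auto
    then show "{} \<notin> (\<alpha> \<star> \<gamma>) m" using beta_empty[OF b[of m]] by (simp only: mult_iff not_False_eq_True simp_thms)
    { fix S T assume ST: "S \<in> (\<alpha> \<star> \<gamma>) m" "T \<in> (\<alpha> \<star> \<gamma>) m"
      have "?D (S \<inter> T) = ?D S \<inter> ?D T" using ST beta_Int_iff[OF d] by (auto simp: mult_iff)
      then show "S \<inter> T \<in> (\<alpha> \<star> \<gamma>) m"
        using ST beta_Int[OF b[of m], of "?D S" "?D T"] by (auto simp: mult_iff) }
    { fix S T assume ST: "S \<in> (\<alpha> \<star> \<gamma>) m" "S \<subseteq> T" "T \<subseteq> Hn m"
      have "?D S \<subseteq> ?D T" using ST beta_mono[OF d] by blast
      then have "?D T \<in> \<gamma> m" using ST beta_mono[OF b[of m], of "?D S" "?D T"] by (auto simp: mult_iff)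
      then show "T \<in> (\<alpha> \<star> \<gamma>) m" using ST by (simp add: mult_iff) }
    { fix S assume S: "S \<subseteq> Hn m"
      have "?D (Hn m - S) = Hn m - ?D S" using S beta_compl_iff[OF d] by auto
      then show "S \<in> (\<alpha> \<star> \<gamma>) m \<or> Hn m - S \<in> (\<alpha> \<star> \<gamma>) m"
        using S beta_compl_iff[OF b[of m], of "?D S"] by (auto simp: mult_iff) }
  qed
  moreover have "res L K A n m ((\<alpha> \<star> \<gamma>) n) = (\<alpha> \<star> \<gamma>) m" if mn: "m \<le> n" for m n
  proof (intro set_eqI)
    fix S
    let ?S = "{x \<in> Hn n. restrict x (U m) \<in> S}"
    have "S \<in> res L K A n m ((\<alpha> \<star> \<gamma>) n) \<longleftrightarrow> S \<subseteq> Hn m \<and> {f \<in> Hn n. ?S \<in> dot n \<alpha> f} \<in> \<gamma> n"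
      by (auto simp: res_def beta_map_iff mult_iff)
    also have "\<dots> \<longleftrightarrow> S \<in> (\<alpha> \<star> \<gamma>) m"
    proof (cases "S \<subseteq> Hn m")
      case True
      have "{f \<in> Hn n. ?S \<in> dot n \<alpha> f} = {f \<in> Hn n. restrict f (U m) \<in> {f \<in> Hn m. S \<in> dot m \<alpha> f}}"
        using dot_restrict[OF \<alpha> _ mn True] restrict_in_H[OF exhaustion mn] by auto
      then show ?thesis
        using True SG_restrict_iff[OF \<gamma> mn, of "{f \<in> Hn m. S \<in> dot m \<alpha> f}"] by (auto simp: mult_iff)
    qed (simp add: mult_iff)
    finally show "S \<in> res L K A n m ((\<alpha> \<star> \<gamma>) n) \<longleftrightarrow> S \<in> (\<alpha> \<star> \<gamma>) m" .
  qed
  ultimately show ?thesis by (simp add: SG_def)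
qed

text \<open>\<open>S(G)\<close> acts on subsets of \<open>H\<^sub>m\<close> by \<open>S \<cdot> \<alpha> = {h. S \<in> \<alpha> \<cdot> h}\<close>; associativity of the
  multiplication is a consequence.\<close>

lemma dot_mult:
  assumes \<alpha>: "\<alpha> \<in> S\<^sub>G" and \<gamma>: "\<gamma> \<in> S\<^sub>G" and f: "f \<in> Hn m" and S: "S \<subseteq> Hn m"
  shows "S \<in> dot m (\<alpha> \<star> \<gamma>) f \<longleftrightarrow> {h \<in> Hn m. S \<in> dot m \<alpha> h} \<in> dot m \<gamma> f"
proof -
  obtain n where n: "m \<le> n" "f ` U m \<subseteq> U n" using f by (rule Hn_range_subset1)
  let ?P = "{x \<in> Hn n. compose (U m) x f \<in> S}"
  have "S \<in> dot m (\<alpha> \<star> \<gamma>) f \<longleftrightarrow> ?P \<in> (\<alpha> \<star> \<gamma>) n"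
    by (rule SG_dot_iff[OF exhaustion mult_closed[OF \<alpha> \<gamma>] S n])
  also have "\<dots> \<longleftrightarrow> {x \<in> Hn n. ?P \<in> dot n \<alpha> x} \<in> \<gamma> n" by (auto simp: mult_iff)
  also have "{x \<in> Hn n. ?P \<in> dot n \<alpha> x} =
      {x \<in> Hn n. compose (U m) x f \<in> {h \<in> Hn m. S \<in> dot m \<alpha> h}}"
    using dot_compose[OF \<alpha> _ f n(2) S] compose_Hn[OF _ f n(2)] by auto
  also have "\<dots> \<in> \<gamma> n \<longleftrightarrow> {h \<in> Hn m. S \<in> dot m \<alpha> h} \<in> dot m \<gamma> f"
    by (intro SG_dot_iff[OF exhaustion \<gamma> _ n, symmetric]) auto
  finally show ?thesis .
qed

lemma mult_assoc:
  assumes \<alpha>: "\<alpha> \<in> S\<^sub>G" and \<gamma>: "\<gamma> \<in> S\<^sub>G"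
  shows "(\<alpha> \<star> \<gamma>) \<star> \<delta> = \<alpha> \<star> (\<gamma> \<star> \<delta>)"
proof (intro ext set_eqI)
  fix m S
  show "S \<in> ((\<alpha> \<star> \<gamma>) \<star> \<delta>) m \<longleftrightarrow> S \<in> (\<alpha> \<star> (\<gamma> \<star> \<delta>)) m"
  proof (cases "S \<subseteq> Hn m")
    case True
    have "{f \<in> Hn m. S \<in> dot m (\<alpha> \<star> \<gamma>) f} =
        {f \<in> Hn m. {h \<in> Hn m. S \<in> dot m \<alpha> h} \<in> dot m \<gamma> f}"
      using dot_mult[OF \<alpha> \<gamma> _ True] by auto
    then show ?thesis using True by (auto simp: mult_iff)
  qed (simp add: mult_iff)
qed


text \<open>The preimage of a basic clopen set \<open>T\<close> in coordinate \<open>n\<close> is the basic clopen set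
  \<open>{f. T \<in> \<alpha> \<cdot> f}\<close> in the same coordinate.\<close>

lemma mult_continuous:
  assumes \<alpha>: "\<alpha> \<in> S\<^sub>G"
  shows "continuous_map (SG_topology L K A) (SG_topology L K A) (mult \<alpha>)"
proof -
  let ?X = "SG_topology L K A"
  have top: "topspace ?X = S\<^sub>G"
    using SG_beta by (auto simp: SG_topology_def)
  have "continuous_map ?X (beta_topology (Hn n)) (\<lambda>\<gamma>. (\<alpha> \<star> \<gamma>) n)" for n
    unfolding beta_topology_def[of "Hn n"]
  proof (rule continuous_on_generated_topo)
    fix V assume "V \<in> basic_clopen (Hn n) ` Pow (Hn n)"
    then obtain T where T: "T \<subseteq> Hn n" "V = basic_clopen (Hn n) T" by auto
    let ?D = "{f \<in> Hn n. T \<in> dot n \<alpha> f}"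
    have "continuous_map ?X (beta_topology (Hn n)) (\<lambda>\<gamma>. \<gamma> n)"
      unfolding SG_topology_def by (intro continuous_map_from_subtopology continuous_map_product_projection) simp
    then have "openin ?X {\<gamma> \<in> topspace ?X. \<gamma> n \<in> basic_clopen (Hn n) ?D}"
      by (rule openin_continuous_map_preimage) (auto intro: openin_basic_clopen)
    moreover have "{\<gamma> \<in> topspace ?X. \<gamma> n \<in> basic_clopen (Hn n) ?D} =
        (\<lambda>\<gamma>. (\<alpha> \<star> \<gamma>) n) -` V \<inter> topspace ?X"
      using T SG_beta SG_beta[OF mult_closed[OF \<alpha>]]
      by (auto simp: top basic_clopen_def mult_iff)
    ultimately show "openin ?X ((\<lambda>\<gamma>. (\<alpha> \<star> \<gamma>) n) -` V \<inter> topspace ?X)" by simp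
  next
    show "(\<lambda>\<gamma>. (\<alpha> \<star> \<gamma>) n) ` topspace ?X \<subseteq> \<Union> (basic_clopen (Hn n) ` Pow (Hn n))"
      using SG_beta[OF mult_closed[OF \<alpha>], of _ n] beta_topD
      by (fastforce simp: top basic_clopen_def)
  qed
  then have "continuous_map ?X (product_topology (\<lambda>n. beta_topology (Hn n)) UNIV) (mult \<alpha>)"
    by (simp add: continuous_map_componentwise_UNIV)
  then show ?thesis
    using mult_closed[OF \<alpha>] unfolding SG_topology_def[of L K A]
    by (subst continuous_map_in_subtopology) (auto simp: top[unfolded SG_topology_def])
qed

lemma ex_idempotent_right_ideal:
  assumes Y: "right_ideal L K A Y" and c: "compactin (SG_topology L K A) Y"
  obtains u where "u \<in> Y" "u \<star> u = u"
proof (rule ex_idempotent[OF _ c, of mult])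
  have YS: "Y \<subseteq> S\<^sub>G" using Y by (simp add: right_ideal_def)
  show "Hausdorff_space (SG_topology L K A)"
    unfolding SG_topology_def
    by (intro Hausdorff_space_subtopology) (simp add: Hausdorff_space_product_topology Hausdorff_beta_topology)
  show "Y \<noteq> {}" using Y by (simp add: right_ideal_def)
  show "a \<star> b \<in> Y" if "a \<in> Y" "b \<in> Y" for a b
    using that Y by (auto simp: right_ideal_def)
  show "a \<star> b \<star> c = a \<star> (b \<star> c)" if "a \<in> Y" "b \<in> Y" "c \<in> Y" for a b c
    using that YS by (intro mult_assoc) auto
  show "continuous_map (subtopology (SG_topology L K A) Y) (SG_topology L K A) (mult a)"
    if "a \<in> Y" for a
    using that YS by (intro continuous_map_from_subtopology mult_continuous) auto
qed


section \<open>Elements of the semigroup as ultrafilter limits of automorphisms\<close>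

text \<open>The limit of \<open>g\<close> along \<open>p\<close>, where \<open>g \<in> G\<close> is identified with the sequence of principal
  ultrafilters at its restrictions.\<close>

definition aut_limit :: "('a \<Rightarrow> 'a) set set \<Rightarrow> nat \<Rightarrow> ('a \<Rightarrow> 'a) set set" where
  "aut_limit p = (\<lambda>n. beta_map G (Hn n) (\<lambda>g. restrict g (U n)) p)"

lemma aut_limit_SG:
  assumes "p \<in> beta G"
  shows "aut_limit p \<in> S\<^sub>G"
proof -
  have "aut_limit p n \<in> beta (Hn n)" for n
    unfolding aut_limit_def using restrict_G assms by (intro beta_map_in_beta) auto
  moreover have "res L K A n m (aut_limit p n) = aut_limit p m" if mn: "m \<le> n" for m n
  proof -
    have "{g \<in> G. restrict g (U n) \<in> {x \<in> Hn n. restrict x (U m) \<in> S}} =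
        {g \<in> G. restrict g (U m) \<in> S}" for S
      using restrict_G U_mono[OF mn] by (auto simp: Int_absorb1)
    then show ?thesis by (auto simp: res_def aut_limit_def beta_map_def)
  qed
  ultimately show ?thesis by (simp add: SG_def)
qed

lemma dot_aut_limit:
  assumes p: "p \<in> beta G" and f: "f \<in> Hn m" and S: "S \<subseteq> Hn m"
  shows "S \<in> dot m (aut_limit p) f \<longleftrightarrow> {g \<in> G. compose (U m) g f \<in> S} \<in> p"
proof -
  obtain n where n: "m \<le> n" "f ` U m \<subseteq> U n" using f by (rule Hn_range_subset1)
  have "S \<in> dot m (aut_limit p) f \<longleftrightarrow> {x \<in> Hn n. compose (U m) x f \<in> S} \<in> aut_limit p n"
    by (rule SG_dot_iff[OF exhaustion aut_limit_SG[OF p] S n])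
  also have "\<dots> \<longleftrightarrow> {g \<in> G. compose (U m) g f \<in> S} \<in> p"
  proof -
    have "{g \<in> G. restrict g (U n) \<in> {x \<in> Hn n. compose (U m) x f \<in> S}} =
        {g \<in> G. compose (U m) g f \<in> S}"
      using restrict_G by (auto simp: compose_restrict[OF n(2)])
    then show ?thesis by (auto simp: aut_limit_def beta_map_iff)
  qed
  finally show ?thesis .
qed

lemma ex_SG_principal:
  assumes f: "f \<in> Hn m"
  obtains \<gamma> where "\<gamma> \<in> S\<^sub>G" "\<gamma> m = principal_on (Hn m) f"
proof -
  obtain g where g: "g \<in> G" "restrict g (U m) = f" using f by (rule extend_to_G)
  let ?\<gamma> = "aut_limit (principal_on G g)"
  have "?\<gamma> \<in> S\<^sub>G" using g by (intro aut_limit_SG principal_on_in_beta)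
  moreover have "?\<gamma> m = principal_on (Hn m) f"
    using g by (simp add: aut_limit_def beta_map_principal)
  ultimately show ?thesis by (rule that)
qed


section \<open>Thick sets\<close>

text \<open>In the notation of characteristic functions: \<open>\<chi>\<^sub>T \<cdot> \<alpha>\<close> is constantly 1.\<close>

definition everywhere :: "nat \<Rightarrow> (nat \<Rightarrow> ('a \<Rightarrow> 'a) set set) \<Rightarrow> ('a \<Rightarrow> 'a) set \<Rightarrow> bool" where
  "everywhere m \<alpha> T \<longleftrightarrow> (\<forall>f\<in>Hn m. T \<in> dot m \<alpha> f)"

lemma everywhere_mono:
  "\<alpha> \<in> S\<^sub>G \<Longrightarrow> everywhere m \<alpha> S \<Longrightarrow> S \<subseteq> T \<Longrightarrow> T \<subseteq> Hn m \<Longrightarrow> everywhere m \<alpha> T"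
  unfolding everywhere_def using beta_mono[OF dot_in_beta] by blast

lemma everywhere_Int:
  "\<alpha> \<in> S\<^sub>G \<Longrightarrow> everywhere m \<alpha> S \<Longrightarrow> everywhere m \<alpha> T \<Longrightarrow> everywhere m \<alpha> (S \<inter> T)"
  unfolding everywhere_def using beta_Int[OF dot_in_beta] by blast

lemma everywhere_at: "\<alpha> \<in> S\<^sub>G \<Longrightarrow> everywhere m \<alpha> T \<Longrightarrow> T \<in> \<alpha> m"
  unfolding everywhere_def using dot_id id_Hn by metis

lemma everywhere_mult_iff:
  assumes \<alpha>: "\<alpha> \<in> S\<^sub>G" and \<gamma>: "\<gamma> \<in> S\<^sub>G" and T: "T \<subseteq> Hn m"
  shows "everywhere m (\<alpha> \<star> \<gamma>) T \<longleftrightarrow> everywhere m \<gamma> {h \<in> Hn m. T \<in> dot m \<alpha> h}"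
  unfolding everywhere_def using dot_mult[OF \<alpha> \<gamma> _ T] by blast

lemma everywhere_mult:
  assumes \<alpha>: "\<alpha> \<in> S\<^sub>G" and \<gamma>: "\<gamma> \<in> S\<^sub>G" and T: "T \<subseteq> Hn m" and e: "everywhere m \<alpha> T"
  shows "everywhere m (\<alpha> \<star> \<gamma>) T"
proof -
  have "{h \<in> Hn m. T \<in> dot m \<alpha> h} = Hn m" using e by (auto simp: everywhere_def)
  moreover have "everywhere m \<gamma> (Hn m)"
    unfolding everywhere_def using beta_topD[OF dot_in_beta[OF \<gamma>]] by blast
  ultimately show ?thesis by (simp add: everywhere_mult_iff[OF \<alpha> \<gamma> T])
qed

text \<open>Any \<open>f\<close> is the \<open>m\<close>-th coordinate of a principal \<open>\<gamma>\<close>, and then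
  \<open>(\<alpha>\<gamma>)(m) = \<alpha> \<cdot> f\<close>.\<close>

lemma everywhereI_right_translates:
  assumes T: "\<And>\<gamma>. \<gamma> \<in> S\<^sub>G \<Longrightarrow> T \<in> (\<alpha> \<star> \<gamma>) m"
  shows "everywhere m \<alpha> T"
  unfolding everywhere_def
proof
  fix f assume "f \<in> Hn m"
  then obtain \<gamma> where "\<gamma> \<in> S\<^sub>G" "\<gamma> m = principal_on (Hn m) f" by (rule ex_SG_principal)
  then show "T \<in> dot m \<alpha> f" using T[of \<gamma>] by (auto simp: mult_iff principal_on_def)
qed

text \<open>A neighbourhood of the constant function 1 in \<open>2\<^bsup>H\<^sub>m\<^esup>\<close> only looks at finitely many
  coordinates.\<close>

lemma Thick_iff_finite:
  "T \<in> Thick L K A m \<longleftrightarrow> T \<subseteq> Hn m \<and>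
    (\<forall>E. finite E \<longrightarrow> E \<subseteq> Hn m \<longrightarrow> (\<exists>g\<in>G. \<forall>f\<in>E. compose (U m) g f \<in> T))"
proof -
  let ?P = "cantor_topology (Hn m)"
  let ?one = "char_fun (Hn m) (Hn m)"
  let ?orb = "act_right L K A m (char_fun (Hn m) T) ` G"
  have orb: "act_right L K A m (char_fun (Hn m) T) g = (\<lambda>f\<in>Hn m. compose (U m) g f \<in> T)"
    if "g \<in> G" for g
    using compose_G[OF that] by (auto simp: act_right_def char_fun_def fun_eq_iff restrict_def)
  have one: "?one \<in> topspace ?P" by (auto simp: cantor_topology_def char_fun_def)
  have "thick L K A m T \<longleftrightarrow>
      (\<forall>E. finite E \<longrightarrow> E \<subseteq> Hn m \<longrightarrow> (\<exists>g\<in>G. \<forall>f\<in>E. compose (U m) g f \<in> T))"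
  proof (intro iffI allI impI)
    fix E assume th: "thick L K A m T" and E: "finite E" "E \<subseteq> Hn m"
    define V where "V = (\<Pi>\<^sub>E f\<in>Hn m. if f \<in> E then {True} else UNIV)"
    have "openin ?P V"
      unfolding V_def cantor_topology_def
      using E(1) by (intro product_topology_basis) (auto elim: finite_subset[rotated])
    moreover have "?one \<in> V" by (auto simp: V_def char_fun_def)
    ultimately obtain c where c: "c \<in> ?orb" "c \<in> V"
      using th unfolding thick_def in_closure_of by blast
    then obtain g where g: "g \<in> G" "c = (\<lambda>f\<in>Hn m. compose (U m) g f \<in> T)" using orb by auto
    have "compose (U m) g f \<in> T" if f: "f \<in> E" for f
    proof -
      have "f \<in> Hn m" using f E by blast
      then have "c f \<in> (if f \<in> E then {True} else UNIV)" using c(2) unfolding V_def by (rule PiE_mem[rotated])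
      then show ?thesis using f g(2) \<open>f \<in> Hn m\<close> by simp
    qed
    then show "\<exists>g\<in>G. \<forall>f\<in>E. compose (U m) g f \<in> T" using g(1) by blast
  next
    assume fin: "\<forall>E. finite E \<longrightarrow> E \<subseteq> Hn m \<longrightarrow> (\<exists>g\<in>G. \<forall>f\<in>E. compose (U m) g f \<in> T)"
    show "thick L K A m T"
      unfolding thick_def in_closure_of
    proof (intro conjI one allI impI)
      fix V assume V: "?one \<in> V \<and> openin ?P V"
      then obtain W where W: "finite {f \<in> Hn m. W f \<noteq> UNIV}" "?one \<in> Pi\<^sub>E (Hn m) W"
        "Pi\<^sub>E (Hn m) W \<subseteq> V"
        unfolding cantor_topology_def openin_product_topology_alt by (auto simp: Ball_def)
      from fin W(1) obtain g where g: "g \<in> G"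
        "\<forall>f\<in>{f \<in> Hn m. W f \<noteq> UNIV}. compose (U m) g f \<in> T"
        by (metis (no_types, lifting) mem_Collect_eq subsetI)
      have "(\<lambda>f\<in>Hn m. compose (U m) g f \<in> T) \<in> Pi\<^sub>E (Hn m) W"
      proof (rule restrict_PiE_iff[THEN iffD2], rule ballI)
        fix f assume f: "f \<in> Hn m"
        have "True \<in> W f" using W(2) f by (auto simp: char_fun_def PiE_iff)
        then show "(compose (U m) g f \<in> T) \<in> W f" using g(2) f by (cases "W f = UNIV") auto
      qed
      then show "\<exists>c. c \<in> ?orb \<and> c \<in> V" using W(3) orb[OF g(1)] g(1) by (metis image_eqI subsetD)
    qed
  qed
  then show ?thesis by (auto simp: Thick_def)
qed

text \<open>If \<open>T\<close> is thick, then the sets \<open>{g. g \<circ> f \<in> T}\<close> have the finite intersection property, and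
  \<open>v\<close> is the limit along an ultrafilter containing them. Conversely, given finitely many \<open>f\<close> with
  ranges in \<open>A n\<close>, the ultrafilter \<open>v n\<close> supplies an embedding \<open>x\<close> with all \<open>x \<circ> f\<close> in \<open>T\<close>, which
  extends to an automorphism.\<close>

lemma Thick_iff_everywhere:
  "T \<in> Thick L K A m \<longleftrightarrow> T \<subseteq> Hn m \<and> (\<exists>v\<in>S\<^sub>G. everywhere m v T)"
proof (cases "T \<subseteq> Hn m")
  case True
  have "\<exists>v\<in>S\<^sub>G. everywhere m v T" if th: "T \<in> Thick L K A m"
  proof -
    let ?C = "\<lambda>f. {g \<in> G. compose (U m) g f \<in> T}"
    obtain p where p: "p \<in> beta G" "?C ` Hn m \<subseteq> p"
    proof (rule ex_beta_if_fip)
      show "?C ` Hn m \<subseteq> Pow G" by auto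
      fix \<D> assume "finite \<D>" "\<D> \<subseteq> ?C ` Hn m"
      then obtain E where E: "finite E" "E \<subseteq> Hn m" "\<D> = ?C ` E"
        by (meson finite_subset_image)
      then obtain g where "g \<in> G" "\<forall>f\<in>E. compose (U m) g f \<in> T"
        using th unfolding Thick_iff_finite by blast
      then show "G \<inter> \<Inter>\<D> \<noteq> {}" using E(3) by auto
    qed
    have "everywhere m (aut_limit p) T"
      unfolding everywhere_def using p(2) dot_aut_limit[OF p(1) _ True] by blast
    then show ?thesis using aut_limit_SG[OF p(1)] by blast
  qed
  moreover have "T \<in> Thick L K A m" if v: "v \<in> S\<^sub>G" "everywhere m v T" for v
    unfolding Thick_iff_finite
  proof (intro conjI True allI impI)
    fix E assume E: "finite E" "E \<subseteq> Hn m"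
    then obtain n where n: "m \<le> n" "\<And>f. f \<in> E \<Longrightarrow> f ` U m \<subseteq> U n"
      using Hn_range_subset[OF E, of m] by metis
    have "{x \<in> Hn n. compose (U m) x f \<in> T} \<in> v n" if "f \<in> E" for f
      using v that E(2) SG_dot_iff[OF exhaustion v(1) True n(1) n(2)[OF that]]
      by (auto simp: everywhere_def)
    then have "{x \<in> Hn n. \<forall>f\<in>E. x \<in> {x \<in> Hn n. compose (U m) x f \<in> T}} \<in> v n"
      using E(1) by (intro beta_finite_Inter[OF SG_beta[OF v(1)]])
    then have "{x \<in> Hn n. \<forall>f\<in>E. x \<in> {x \<in> Hn n. compose (U m) x f \<in> T}} \<noteq> {}"
      using beta_empty[OF SG_beta[OF v(1)]] by metis
    then obtain x where x: "x \<in> Hn n" "\<forall>f\<in>E. compose (U m) x f \<in> T" by auto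
    obtain g where g: "g \<in> G" "restrict g (U n) = x" using x(1) by (rule extend_to_G)
    have "compose (U m) g f \<in> T" if "f \<in> E" for f
      using x(2) that compose_restrict[OF n(2)[OF that], of g] g(2) by auto
    then show "\<exists>g\<in>G. \<forall>f\<in>E. compose (U m) g f \<in> T" using g(1) by blast
  qed
  ultimately show ?thesis using True by blast
qed (simp add: Thick_def)

lemma Thick_mono: "S \<in> Thick L K A m \<Longrightarrow> S \<subseteq> T \<Longrightarrow> T \<subseteq> Hn m \<Longrightarrow> T \<in> Thick L K A m"
  unfolding Thick_iff_everywhere using everywhere_mono by blast

lemma empty_not_Thick: "{} \<notin> Thick L K A m"
  unfolding Thick_iff_everywhere using everywhere_at beta_empty[OF SG_beta] by blast

lemma Thick_ultrafilter_memI: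
  assumes "F \<in> beta_family (Hn m) (Thick L K A m)" "B \<subseteq> Hn m"
    and "\<And>V. V \<in> F \<Longrightarrow> V \<inter> B \<in> Thick L K A m"
  shows "B \<in> F"
  using assms(1) Thick_mono empty_not_Thick assms(2,3) by (rule beta_family_memI)


section \<open>Inverse limits\<close>

lemma res_res:
  assumes "k \<le> m" "m \<le> n"
  shows "res L K A m k (res L K A n m p) = res L K A n k p"
proof -
  have "{x \<in> Hn n. restrict x (U m) \<in> {x \<in> Hn m. restrict x (U k) \<in> S}} =
      {x \<in> Hn n. restrict x (U k) \<in> S}" for S
    using restrict_in_H[OF exhaustion assms(2)] U_mono[OF assms(1)] by (auto simp: Int_absorb1)
  then show ?thesis by (auto simp: res_def beta_map_def)
qed

lemma res_self:
  assumes p: "p \<in> beta (Hn n)"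
  shows "res L K A n n p = p"
proof -
  have "{x \<in> Hn n. restrict x (U n) \<in> S} = S" if "S \<subseteq> Hn n" for S
    using that by (auto simp: restrict_Hn_self subset_iff)
  then show ?thesis using beta_subsetD[OF p] by (auto simp: res_def beta_map_def)
qed

lemma inverse_limit_subset_beta:
  assumes "is_inverse_limit L K A Y Ys"
  shows "Ys m \<subseteq> beta (Hn m)"
proof -
  have "closedin (beta_topology (Hn m)) (Ys m)" using assms by (simp add: is_inverse_limit_def)
  from closedin_subset[OF this] show ?thesis by simp
qed

text \<open>As the index set is \<open>\<nat>\<close> and the bonding maps are onto, a thread through \<open>p\<close> can be chosen
  step by step.\<close>

lemma inverse_limit_coordinate_surj:
  assumes lim: "is_inverse_limit L K A Y Ys" and p: "p \<in> Ys m"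
  obtains y where "y \<in> Y" "y m = p"
proof -
  have onto: "res L K A n k ` Ys n = Ys k" if "k \<le> n" for k n
    using lim that by (auto simp: is_inverse_limit_def)
  have "\<exists>q. \<forall>k. (q k \<in> Ys (m + k) \<and> (k = 0 \<longrightarrow> q k = p)) \<and>
      res L K A (m + Suc k) (m + k) (q (Suc k)) = q k"
  proof (rule dependent_nat_choice)
    show "\<exists>q. q \<in> Ys (m + 0) \<and> (0 = (0::nat) \<longrightarrow> q = p)" using p by simp
    fix q k assume "q \<in> Ys (m + k) \<and> (k = 0 \<longrightarrow> q = p)"
    then have "q \<in> res L K A (m + Suc k) (m + k) ` Ys (m + Suc k)" by (simp add: onto)
    then show "\<exists>q'. (q' \<in> Ys (m + Suc k) \<and> (Suc k = 0 \<longrightarrow> q' = p)) \<and>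
        res L K A (m + Suc k) (m + k) q' = q" by auto
  qed
  then obtain q where q: "\<And>k. q k \<in> Ys (m + k)" "q 0 = p"
    and succ: "\<And>k. res L K A (m + Suc k) (m + k) (q (Suc k)) = q k" by metis
  have down: "res L K A (m + b) (m + a) (q b) = q a" if "a \<le> b" for a b
    using that
  proof (induction b rule: dec_induct)
    case base
    show ?case using q(1)[of a] inverse_limit_subset_beta[OF lim, of "m + a"] by (intro res_self) auto
  next
    case (step b)
    have "res L K A (m + Suc b) (m + a) (q (Suc b)) =
        res L K A (m + b) (m + a) (res L K A (m + Suc b) (m + b) (q (Suc b)))"
      using step by (intro res_res[symmetric]) auto
    then show ?case using step succ by simp
  qed
  (* The choice only fixes the coordinates from m on; the others are images of these. *)
  define y where "y n = res L K A (m + n) n (q n)" for n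
  have yY: "y n \<in> Ys n" for n
    using onto[of n "m + n"] q(1) by (auto simp: y_def)
  have "res L K A n k (y n) = y k" if "k \<le> n" for k n
  proof -
    have "res L K A n k (y n) = res L K A (m + n) k (q n)"
      unfolding y_def using that by (intro res_res) auto
    also have "\<dots> = res L K A (m + k) k (res L K A (m + n) (m + k) (q n))"
      using that by (intro res_res[symmetric]) auto
    finally show ?thesis using down[OF that] by (simp add: y_def)
  qed
  moreover have "y n \<in> beta (Hn n)" for n using yY inverse_limit_subset_beta[OF lim] by blast
  ultimately have "y \<in> S\<^sub>G" by (simp add: SG_def)
  then have "y \<in> Y" using lim yY by (auto simp: is_inverse_limit_def)
  moreover have "y m = p" using down[of 0 m] q(2) by (simp add: y_def)
  ultimately show ?thesis by (rule that)
qed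

lemma nbhd_filter_iff:
  assumes lim: "is_inverse_limit L K A Y Ys"
  shows "T \<in> nbhd_filter (Hn m) (Ys m) \<longleftrightarrow> T \<subseteq> Hn m \<and> (\<forall>y\<in>Y. T \<in> y m)"
proof -
  have "y m \<in> Ys m" if "y \<in> Y" for y using lim that by (auto simp: is_inverse_limit_def)
  moreover have "T \<in> p" if "\<forall>y\<in>Y. T \<in> y m" "p \<in> Ys m" for p
    using that inverse_limit_coordinate_surj[OF lim that(2)] by metis
  ultimately show ?thesis
    using inverse_limit_subset_beta[OF lim, of m]
    by (auto simp: nbhd_filter_def basic_clopen_def subset_iff)
qed

text \<open>Here closedness of the \<open>Ys m\<close> enters: they are determined by their neighbourhood filters.\<close>

lemma inverse_limit_memI:
  assumes lim: "is_inverse_limit L K A Y Ys" and \<alpha>: "\<alpha> \<in> S\<^sub>G"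
    and F: "\<And>m T. T \<in> nbhd_filter (Hn m) (Ys m) \<Longrightarrow> T \<in> \<alpha> m"
  shows "\<alpha> \<in> Y"
proof -
  have "\<alpha> m \<in> Ys m" for m
    using lim F mem_closed_iff_nbhd_filter_subset[OF _ SG_beta[OF \<alpha>], of m "Ys m"]
    by (auto simp: is_inverse_limit_def)
  then show ?thesis using lim \<alpha> by (simp add: is_inverse_limit_def)
qed


section \<open>Minimal right ideals have maximal thick filters\<close>

lemma minimal_right_idealD:
  assumes "minimal_right_ideal L K A Y"
  shows "Y \<subseteq> S\<^sub>G" "Y \<noteq> {}" "\<And>\<alpha> \<gamma>. \<alpha> \<in> Y \<Longrightarrow> \<gamma> \<in> S\<^sub>G \<Longrightarrow> \<alpha> \<star> \<gamma> \<in> Y"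
    "\<And>R. right_ideal L K A R \<Longrightarrow> R \<subseteq> Y \<Longrightarrow> R = Y"
  using assms by (auto simp: minimal_right_ideal_def right_ideal_def)

text \<open>Right to left, minimality acts as an all-or-nothing principle: the points of \<open>Y\<close> at which \<open>T\<close>
  holds everywhere form a right ideal.\<close>

lemma nbhd_filter_minimal_iff:
  assumes min: "minimal_right_ideal L K A Y" and lim: "is_inverse_limit L K A Y Ys"
    and T: "T \<subseteq> Hn m"
  shows "T \<in> nbhd_filter (Hn m) (Ys m) \<longleftrightarrow> (\<exists>z\<in>Y. everywhere m z T)"
proof
  note Y = minimal_right_idealD[OF min]
  assume "T \<in> nbhd_filter (Hn m) (Ys m)"
  then have "\<forall>y\<in>Y. T \<in> y m" by (simp add: nbhd_filter_iff[OF lim])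
  then have "everywhere m z T" if "z \<in> Y" for z
    using Y(3)[OF that] by (intro everywhereI_right_translates) blast
  then show "\<exists>z\<in>Y. everywhere m z T" using Y(2) by blast
next
  note Y = minimal_right_idealD[OF min]
  assume z: "\<exists>z\<in>Y. everywhere m z T"
  let ?R = "{z \<in> Y. everywhere m z T}"
  have "right_ideal L K A ?R"
    unfolding right_ideal_def using z Y(1,3) everywhere_mult[OF _ _ T] by auto
  then have "?R = Y" by (rule Y(4)) auto
  then have "\<forall>y\<in>Y. T \<in> y m" using everywhere_at Y(1) by blast
  then show "T \<in> nbhd_filter (Hn m) (Ys m)" using T by (simp add: nbhd_filter_iff[OF lim])
qed

text \<open>The heart of the matter. A thick set \<open>T \<in> F'\<close> holds everywhere at some \<open>v\<close>, but \<open>v\<close> need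
  not lie in \<open>Y\<close>. Idempotence of \<open>u \<in> Y\<close> makes \<open>T\<close> indistinguishable from its
  translate \<open>Q\<close> modulo \<open>F\<^sub>m\<close>, and thickness of \<open>Q\<close>, witnessed by \<open>v\<close>, turns into \<open>T\<close>
  holding everywhere at \<open>uv\<close>, a point of \<open>Y\<close>.\<close>

lemma nbhd_filter_minimal_maximal:
  assumes min: "minimal_right_ideal L K A Y" and lim: "is_inverse_limit L K A Y Ys"
    and comp: "compactin (SG_topology L K A) Y"
    and F': "family_filter (Hn m) (Thick L K A m) F'" "nbhd_filter (Hn m) (Ys m) \<subseteq> F'"
  shows "F' \<subseteq> nbhd_filter (Hn m) (Ys m)"
proof
  fix T assume TF: "T \<in> F'"
  note Y = minimal_right_idealD[OF min]
  have T: "T \<subseteq> Hn m" using F' TF by (auto simp: family_filter_def filter_on_def)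
  obtain u where u: "u \<in> Y" "u \<star> u = u"
    using min comp unfolding minimal_right_ideal_def by (metis ex_idempotent_right_ideal)
  then have uS: "u \<in> S\<^sub>G" using Y(1) by blast
  define Q where "Q = {f \<in> Hn m. T \<in> dot m u f}"
  define S where "S = {f \<in> Hn m. f \<in> T \<longleftrightarrow> f \<in> Q}"
  have "everywhere m u S"
    unfolding everywhere_def
  proof
    fix f assume f: "f \<in> Hn m"
    note d = dot_in_beta[OF uS f]
    have TQ: "T \<in> dot m u f \<longleftrightarrow> Q \<in> dot m u f"
      using dot_mult[OF uS uS f T] u(2) by (simp add: Q_def)
    have QH: "Q \<subseteq> Hn m" by (auto simp: Q_def)
    show "S \<in> dot m u f"
    proof (cases "T \<in> dot m u f")
      case True
      then have "T \<inter> Q \<in> dot m u f" using TQ beta_Int[OF d] by simp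
      then show ?thesis by (rule beta_mono[OF d]) (use T in \<open>auto simp: S_def\<close>)
    next
      case False
      then have "(Hn m - T) \<inter> (Hn m - Q) \<in> dot m u f"
        using TQ beta_Int[OF d] beta_compl_iff[OF d T] beta_compl_iff[OF d QH] by simp
      then show ?thesis by (rule beta_mono[OF d]) (auto simp: S_def)
    qed
  qed
  then have "S \<in> nbhd_filter (Hn m) (Ys m)"
    using u(1) nbhd_filter_minimal_iff[OF min lim, of S m] by (auto simp: S_def)
  then have "S \<inter> T \<in> F'" using F' TF unfolding family_filter_def filter_on_def by blast
  then have "S \<inter> T \<in> Thick L K A m" using F'(1) by (auto simp: family_filter_def)
  then have "Q \<in> Thick L K A m" by (rule Thick_mono) (auto simp: S_def Q_def)
  then obtain v where v: "v \<in> S\<^sub>G" "everywhere m v Q" by (auto simp: Thick_iff_everywhere)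
  then have "everywhere m (u \<star> v) T" by (simp add: everywhere_mult_iff[OF uS v(1) T] Q_def)
  then show "T \<in> nbhd_filter (Hn m) (Ys m)"
    using nbhd_filter_minimal_iff[OF min lim T] Y(3)[OF u(1) v(1)] by blast
qed

lemma nbhd_filter_minimal_Thick_ultrafilter:
  assumes min: "minimal_right_ideal L K A Y" and lim: "is_inverse_limit L K A Y Ys"
    and comp: "compactin (SG_topology L K A) Y"
  shows "nbhd_filter (Hn m) (Ys m) \<in> beta_family (Hn m) (Thick L K A m)"
proof -
  note Y = minimal_right_idealD[OF min]
  let ?F = "nbhd_filter (Hn m) (Ys m)"
  obtain y where "y \<in> Y" using Y(2) by blast
  then have "y m \<in> Ys m" using lim by (auto simp: is_inverse_limit_def)
  then have "filter_on (Hn m) ?F"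
    using inverse_limit_subset_beta[OF lim] by (intro filter_on_nbhd_filter) auto
  moreover have "?F \<subseteq> Thick L K A m"
  proof
    fix T assume T: "T \<in> ?F"
    then have "T \<subseteq> Hn m" by (simp add: nbhd_filter_def)
    with T show "T \<in> Thick L K A m"
      using nbhd_filter_minimal_iff[OF min lim] Y(1) by (auto simp: Thick_iff_everywhere)
  qed
  moreover have "F' = ?F" if "family_filter (Hn m) (Thick L K A m) F'" "?F \<subseteq> F'" for F'
    using nbhd_filter_minimal_maximal[OF min lim comp that] that(2) by (rule subset_antisym)
  ultimately show ?thesis by (simp add: beta_family_def family_filter_def)
qed


section \<open>Maximal thick filters give minimal right ideals\<close>

text \<open>For \<open>f\<close> the inclusion of \<open>A m\<close> the preimage lies in the filter because \<open>Ys n\<close> maps into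
  \<open>Ys m\<close>. Where this preimage holds everywhere, so does \<open>T\<close>, since each
  embedding of \<open>A m\<close> is the restriction of one of \<open>A n\<close>; hence so does the preimage for any
  other \<open>f\<close>. So the latter meets every filter set in a thick set, and maximality applies.\<close>

lemma preimage_in_nbhd_filter:
  assumes lim: "is_inverse_limit L K A Y Ys"
    and max: "nbhd_filter (Hn n) (Ys n) \<in> beta_family (Hn n) (Thick L K A n)"
    and T: "T \<in> nbhd_filter (Hn m) (Ys m)"
    and f: "f \<in> Hn m" and n: "m \<le> n" "f ` U m \<subseteq> U n"
  shows "{x \<in> Hn n. compose (U m) x f \<in> T} \<in> nbhd_filter (Hn n) (Ys n)"
proof (rule Thick_ultrafilter_memI[OF max])
  let ?B = "{x \<in> Hn n. compose (U m) x f \<in> T}"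
  let ?T' = "{x \<in> Hn n. restrict x (U m) \<in> T}"
  show "?B \<subseteq> Hn n" by auto
  have TH: "T \<subseteq> Hn m" and Ty: "\<forall>y\<in>Y. T \<in> y m" using T by (auto simp: nbhd_filter_iff[OF lim])
  have YS: "Y \<subseteq> S\<^sub>G" using lim by (auto simp: is_inverse_limit_def)
  have T'F: "?T' \<in> nbhd_filter (Hn n) (Ys n)"
    using Ty YS SG_restrict_iff[OF _ n(1) TH] by (auto simp: nbhd_filter_iff[OF lim])
  fix V assume V: "V \<in> nbhd_filter (Hn n) (Ys n)"
  have F: "filter_on (Hn n) (nbhd_filter (Hn n) (Ys n))"
    "nbhd_filter (Hn n) (Ys n) \<subseteq> Thick L K A n"
    using max by (auto simp: beta_family_def family_filter_def)
  have VH: "V \<subseteq> Hn n" using V by (simp add: nbhd_filter_def)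
  have "V \<inter> ?T' \<in> Thick L K A n" using F V T'F by (auto simp: filter_on_def)
  then obtain v where v: "v \<in> S\<^sub>G" "everywhere n v (V \<inter> ?T')" by (auto simp: Thick_iff_everywhere)
  have eV: "everywhere n v V" and eT': "everywhere n v ?T'"
    using everywhere_mono[OF v] VH by auto
  have eT: "T \<in> dot m v h" if h: "h \<in> Hn m" for h
  proof -
    obtain g where g: "g \<in> G" "restrict g (U m) = h" using h by (rule extend_to_G)
    have x: "restrict g (U n) \<in> Hn n" using g(1) by (rule restrict_G)
    have "restrict (restrict g (U n)) (U m) = h" using g(2) U_mono[OF n(1)] by (simp add: Int_absorb1)
    then show ?thesis using dot_restrict[OF v(1) x n(1) TH] eT' x by (simp add: everywhere_def)
  qed
  have "everywhere n v ?B"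
    unfolding everywhere_def
  proof
    fix x assume x: "x \<in> Hn n"
    show "?B \<in> dot n v x"
      using eT[OF compose_Hn[OF x f n(2)]] dot_compose[OF v(1) x f n(2) TH] by simp
  qed
  then have "everywhere n v (V \<inter> ?B)" using everywhere_Int[OF v(1) eV] by blast
  then show "V \<inter> ?B \<in> Thick L K A n" using v(1) VH by (auto simp: Thick_iff_everywhere)
qed

context
  fixes Y :: "(nat \<Rightarrow> ('a \<Rightarrow> 'a) set set) set" and Ys :: "nat \<Rightarrow> ('a \<Rightarrow> 'a) set set set"
  assumes lim: "is_inverse_limit L K A Y Ys"
    and max: "\<And>m. nbhd_filter (Hn m) (Ys m) \<in> beta_family (Hn m) (Thick L K A m)"
begin

lemma nbhd_filter_everywhere:
  assumes T: "T \<in> nbhd_filter (Hn m) (Ys m)" and y: "y \<in> Y"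
  shows "everywhere m y T"
  unfolding everywhere_def
proof
  fix f assume f: "f \<in> Hn m"
  obtain n where n: "m \<le> n" "f ` U m \<subseteq> U n" using f by (rule Hn_range_subset1)
  have yS: "y \<in> S\<^sub>G" using lim y by (simp add: is_inverse_limit_def)
  have "{x \<in> Hn n. compose (U m) x f \<in> T} \<in> y n"
    using preimage_in_nbhd_filter[OF lim max T f n] y by (simp add: nbhd_filter_iff[OF lim])
  then show "T \<in> dot m y f"
    using SG_dot_iff[OF exhaustion yS _ n] T by (simp add: nbhd_filter_def)
qed

lemma right_ideal_if_Thick_ultrafilters: "right_ideal L K A Y"
  unfolding right_ideal_def
proof (intro conjI ballI)
  show YS: "Y \<subseteq> S\<^sub>G" using lim by (auto simp: is_inverse_limit_def)
  have "filter_on (Hn 0) (nbhd_filter (Hn 0) (Ys 0))"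
    using max[of 0] by (auto simp: beta_family_def family_filter_def)
  then have "{} \<notin> nbhd_filter (Hn 0) (Ys 0)" by (simp add: filter_on_def)
  then show "Y \<noteq> {}" by (auto simp: nbhd_filter_iff[OF lim])
  fix y \<gamma> assume y: "y \<in> Y" and \<gamma>: "\<gamma> \<in> S\<^sub>G"
  then have yS: "y \<in> S\<^sub>G" using YS by blast
  show "y \<star> \<gamma> \<in> Y"
  proof (rule inverse_limit_memI[OF lim mult_closed[OF yS \<gamma>]])
    fix m T assume T: "T \<in> nbhd_filter (Hn m) (Ys m)"
    then have TH: "T \<subseteq> Hn m" by (simp add: nbhd_filter_def)
    have "everywhere m (y \<star> \<gamma>) T"
      by (rule everywhere_mult[OF yS \<gamma> TH nbhd_filter_everywhere[OF T y]])
    then show "T \<in> (y \<star> \<gamma>) m" by (rule everywhere_at[OF mult_closed[OF yS \<gamma>]])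
  qed
qed

text \<open>Otherwise the complement of \<open>S\<close> holds everywhere at \<open>r\<close>, as all sets of the filter do; by
  maximality the complement lies in the filter, hence in \<open>y n\<close>.\<close>

lemma right_translates_meet_nbhd:
  assumes r: "r \<in> Y" and y: "y \<in> Y" and S: "S \<in> y n"
  obtains f where "f \<in> Hn n" "S \<in> dot n r f"
proof -
  have rS: "r \<in> S\<^sub>G" and yS: "y \<in> S\<^sub>G" using lim r y by (auto simp: is_inverse_limit_def)
  have SH: "S \<subseteq> Hn n" using SG_beta[OF yS] S by (rule beta_subsetD)
  have "\<exists>f\<in>Hn n. S \<in> dot n r f"
  proof (rule ccontr)
    assume no: "\<not> (\<exists>f\<in>Hn n. S \<in> dot n r f)"
    then have e: "everywhere n r (Hn n - S)"
      using beta_compl_iff[OF dot_in_beta[OF rS] SH] by (auto simp: everywhere_def)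
    have "Hn n - S \<in> nbhd_filter (Hn n) (Ys n)"
    proof (rule Thick_ultrafilter_memI[OF max])
      fix V assume V: "V \<in> nbhd_filter (Hn n) (Ys n)"
      have "everywhere n r (V \<inter> (Hn n - S))"
        by (rule everywhere_Int[OF rS nbhd_filter_everywhere[OF V r] e])
      then show "V \<inter> (Hn n - S) \<in> Thick L K A n" using rS by (auto simp: Thick_iff_everywhere)
    qed auto
    then have "Hn n - S \<in> y n" using y by (simp add: nbhd_filter_iff[OF lim])
    then show False using S by (simp add: beta_compl_iff[OF SG_beta[OF yS] SH])
  qed
  then show ?thesis using that by blast
qed

text \<open>\<open>\<gamma>\<close> is the limit along an ultrafilter containing the sets \<open>{g. S \<in> r \<cdot> (g|A\<^sub>m)}\<close> for
  \<open>S \<in> y m\<close>. For their finite intersection property, finitely many conditions are pulled back to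
  a single one on a common \<open>H\<^sub>n\<close>.\<close>

lemma right_translation_surj:
  assumes r: "r \<in> Y" and y: "y \<in> Y"
  obtains \<gamma> where "\<gamma> \<in> S\<^sub>G" "r \<star> \<gamma> = y"
proof -
  have rS: "r \<in> S\<^sub>G" and yS: "y \<in> S\<^sub>G" using lim r y by (auto simp: is_inverse_limit_def)
  define I where "I = {(m, S). S \<in> y m}"
  define C where "C = (\<lambda>(m, S). {g \<in> G. S \<in> dot m r (restrict g (U m))})"
  obtain p where p: "p \<in> beta G" "C ` I \<subseteq> p"
  proof (rule ex_beta_if_fip)
    show "C ` I \<subseteq> Pow G" by (auto simp: C_def)
    fix \<D> assume "finite \<D>" "\<D> \<subseteq> C ` I"
    then obtain J where J: "finite J" "J \<subseteq> I" "\<D> = C ` J" by (meson finite_subset_image)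
    have "\<exists>n. \<forall>i\<in>J. fst i \<le> n"
      using finite_nat_set_iff_bounded_le[of "fst ` J"] J(1) by auto
    then obtain n where n: "\<And>i. i \<in> J \<Longrightarrow> fst i \<le> n" by blast
    let ?P = "\<lambda>i. {x \<in> Hn n. restrict x (U (fst i)) \<in> snd i}"
    have JH: "snd i \<subseteq> Hn (fst i)" and "?P i \<in> y n" if i: "i \<in> J" for i
    proof -
      have yi: "snd i \<in> y (fst i)" using i J(2) by (auto simp: I_def)
      then show H: "snd i \<subseteq> Hn (fst i)" by (rule beta_subsetD[OF SG_beta[OF yS]])
      show "?P i \<in> y n" using SG_restrict_iff[OF yS n[OF i] H] yi by simp
    qed
    then have "{x \<in> Hn n. \<forall>i\<in>J. x \<in> ?P i} \<in> y n"
      using J(1) by (intro beta_finite_Inter[OF SG_beta[OF yS]])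
    then obtain f where f: "f \<in> Hn n" "{x \<in> Hn n. \<forall>i\<in>J. x \<in> ?P i} \<in> dot n r f"
      by (rule right_translates_meet_nbhd[OF r y])
    obtain g where g: "g \<in> G" "restrict g (U n) = f" using f(1) by (rule extend_to_G)
    have "g \<in> C i" if i: "i \<in> J" for i
    proof -
      have "?P i \<in> dot n r f"
        using f(2) by (rule beta_mono[OF dot_in_beta[OF rS f(1)]]) (use i in auto)
      then have "snd i \<in> dot (fst i) r (restrict f (U (fst i)))"
        using dot_restrict[OF rS f(1) n[OF i] JH[OF i]] by simp
      moreover have "restrict f (U (fst i)) = restrict g (U (fst i))"
        using g(2) U_mono[OF n[OF i]] by (auto simp: Int_absorb1)
      ultimately show ?thesis using g(1) by (simp add: C_def case_prod_beta)
    qed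
    then show "G \<inter> \<Inter>\<D> \<noteq> {}" using g(1) J(3) by auto
  qed
  let ?\<gamma> = "aut_limit p"
  have \<gamma>: "?\<gamma> \<in> S\<^sub>G" using p(1) by (rule aut_limit_SG)
  have "y m \<subseteq> (r \<star> ?\<gamma>) m" for m
  proof
    fix S assume S: "S \<in> y m"
    then have "C (m, S) \<in> p" using p(2) by (auto simp: I_def)
    moreover have "{g \<in> G. restrict g (U m) \<in> {f \<in> Hn m. S \<in> dot m r f}} = C (m, S)"
      using restrict_G by (auto simp: C_def)
    ultimately have "{f \<in> Hn m. S \<in> dot m r f} \<in> ?\<gamma> m" by (auto simp: aut_limit_def beta_map_iff)
    then show "S \<in> (r \<star> ?\<gamma>) m" using beta_subsetD[OF SG_beta[OF yS] S] by (simp add: mult_iff)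
  qed
  then have "y m = (r \<star> ?\<gamma>) m" for m
    by (rule beta_eqI[OF SG_beta[OF yS] SG_beta[OF mult_closed[OF rS \<gamma>]]])
  then have "r \<star> ?\<gamma> = y" by (intro ext) simp
  with \<gamma> show ?thesis by (rule that)
qed

lemma minimal_right_ideal_if_Thick_ultrafilters: "minimal_right_ideal L K A Y"
  unfolding minimal_right_ideal_def
proof (intro conjI allI impI right_ideal_if_Thick_ultrafilters)
  fix R assume R: "right_ideal L K A R" "R \<subseteq> Y"
  then obtain r where r: "r \<in> R" by (auto simp: right_ideal_def)
  have "y \<in> R" if y: "y \<in> Y" for y
  proof -
    obtain \<gamma> where "\<gamma> \<in> S\<^sub>G" "r \<star> \<gamma> = y"
      using r R(2) y by (meson right_translation_surj subsetD)
    then show ?thesis using R(1) r by (auto simp: right_ideal_def)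
  qed
  then show "R = Y" using R(2) by blast
qed

end

end

theorem theorem3p5:
  fixes L :: "'r language"
    and K :: "('a, 'r) rel_structure"
    and A :: "nat \<Rightarrow> ('a, 'r) rel_structure"
    and Y :: "(nat \<Rightarrow> ('a \<Rightarrow> 'a) set set) set"
    and Ys :: "nat \<Rightarrow> ('a \<Rightarrow> 'a) set set set"
  assumes "fraisse_structure L K"
    and "exhaustion L K A"
    and "is_inverse_limit L K A Y Ys"
    and "compactin (SG_topology L K A) Y"
  shows "minimal_right_ideal L K A Y \<longleftrightarrow>
    (\<forall>m. nbhd_filter (H L K A m) (Ys m) \<in> beta_family (H L K A m) (Thick L K A m))"
proof -
  interpret fraisse_exhaustion L K A
    using assms(1,2) by (rule fraisse_exhaustion.intro)
  show ?thesis
    using nbhd_filter_minimal_Thick_ultrafilter[OF _ assms(3,4)]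
      minimal_right_ideal_if_Thick_ultrafilters[OF assms(3)] by blast
qed

end
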